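(* Let $0<\alpha<1/3$. There exists $\gamma_*\in(1,\infty)$ such that for every $d>0$ the following hold. (1) If $1<\gamma\le\gamma_*$, the system $\dot\theta=G_1(\theta,W)$, $\dot W=G_2(\theta,W)$ has no equilibria in $\Omega_\gamma$, and for every $(\theta_0,W_0)\in\Omega_\gamma$ the following are equivalent: (i) the solution starting from $(\theta_0,W_0)$ is a leapfrogging solution; (ii) $\mathcal G(\theta_0,W_0)>\dfrac{\pi\gamma^{3/2}}{2d^{1/2}}$. (2) If $\gamma>\gamma_*$, the system has exactly one equilibrium $(\theta_*,0)$ in $\Omega_\gamma$, with $\theta_*\in(\theta_\gamma,\infty)$; there is a unique $\overline\theta\in(0,\theta_\gamma)$ with $\mathcal G(\overline\theta,0)=\mathcal G(\theta_*,0)$; and for every $(\theta_0,W_0)\in\Omega_\gamma$ the following are equivalent: (iii) the solution starting from $(\theta_0,W_0)$ is a leapfrogging solution; (iv) $\theta_0\in(\overline\theta,\theta_* )$ and $\mathcal G(\theta_0,W_0)>\mathcal G(\theta_*,0)$.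
   Context: For $\gamma>1$, $d>0$, $\alpha>0$: let $\theta_\gamma=\operatorname{artanh}(\gamma^{-1/2})$ (the unique $\theta>0$ with $\cosh\theta=\gamma^{1/2}\sinh\theta$) and $\Omega_\gamma=\{(\theta,W)\in\mathbb{R}^2:\ \theta>0,\ W\in\mathbb{R},\ (\theta,W)\ne(\theta_\gamma,0)\}$. Put $E_\gamma(\theta,W)=\frac{d}{\gamma}(\cosh\theta-\gamma^{1/2}\sinh\theta)^2+W^2$, $$G_1(\theta,W)=-\frac{\alpha\gamma^{1/2}W}{E_\gamma^{3/2}},\qquad G_2(\theta,W)=-\frac{1}{d^{1/2}}\Big(\frac{\gamma^{3/2}}{\cosh\theta}+\frac{1}{\sinh\theta}\Big)+\frac{\alpha d(\sinh\theta-\gamma^{1/2}\cosh\theta)(\cosh\theta-\gamma^{1/2}\sinh\theta)}{\gamma^{1/2}E_\gamma^{3/2}},$$ $$\mathcal G(\theta,W)=\frac{1}{d^{1/2}}\Big(2\gamma^{3/2}\arctan\big(\tanh(\theta/2)\big)+\log\big(\tanh(\theta/2)\big)\Big)+\frac{\alpha\gamma^{1/2}}{E_\gamma^{1/2}}.$$ Solutions of the system with data in $\Omega_\gamma$ exist for all $t\in\mathbb{R}$. A solution is called a leapfrogging solution if it is non-constant and periodic and its orbit $\{(\theta(t),W(t)):t\in\mathbb{R}\}$ is a closed curve in $\Omega_\gamma$ revolving around $(\theta_\gamma,0)$, i.e. $(\theta_\gamma,0)$ lies in the bounded component of the complement of the orbit in $\mathbb{R}^2$. (The system models two coaxial circular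 vortex filaments with vorticities of opposite sign, of radii $(d/\gamma)^{1/2}\cosh\theta$ and $d^{1/2}\sinh\theta$ and axial separation $W$.) *)

theory Defs
  imports "HOL-Analysis.Analysis"
begin

definition theta_g :: "real \<Rightarrow> real" where
  "theta_g \<gamma> = artanh (1 / sqrt \<gamma>)"

definition Omega :: "real \<Rightarrow> (real \<times> real) set" where
  "Omega \<gamma> = {(\<theta>, W). \<theta> > 0 \<and> (\<theta>, W) \<noteq> (theta_g \<gamma>, 0)}"

definition E :: "real \<Rightarrow> real \<Rightarrow> real \<Rightarrow> real \<Rightarrow> real" where
  "E d \<gamma> \<theta> W = d / \<gamma> * (cosh \<theta> - sqrt \<gamma> * sinh \<theta>)\<^sup>2 + W\<^sup>2"

definition G1 :: "real \<Rightarrow> real \<Rightarrow> real \<Rightarrow> real \<Rightarrow> real \<Rightarrow> real" where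
  "G1 d \<gamma> \<alpha> \<theta> W = - (\<alpha> * sqrt \<gamma> * W / (E d \<gamma> \<theta> W) powr (3/2))"

definition G2 :: "real \<Rightarrow> real \<Rightarrow> real \<Rightarrow> real \<Rightarrow> real \<Rightarrow> real" where
  "G2 d \<gamma> \<alpha> \<theta> W =
     - (1 / sqrt d) * (\<gamma> powr (3/2) / cosh \<theta> + 1 / sinh \<theta>)
     + \<alpha> * d * (sinh \<theta> - sqrt \<gamma> * cosh \<theta>) * (cosh \<theta> - sqrt \<gamma> * sinh \<theta>)
        / (sqrt \<gamma> * (E d \<gamma> \<theta> W) powr (3/2))"

definition Gcal :: "real \<Rightarrow> real \<Rightarrow> real \<Rightarrow> real \<Rightarrow> real \<Rightarrow> real" where
  "Gcal d \<gamma> \<alpha> \<theta> W =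
     (1 / sqrt d) * (2 * \<gamma> powr (3/2) * arctan (tanh (\<theta> / 2)) + ln (tanh (\<theta> / 2)))
     + \<alpha> * sqrt \<gamma> / (E d \<gamma> \<theta> W) powr (1/2)"

definition is_solution :: "real \<Rightarrow> real \<Rightarrow> real \<Rightarrow> (real \<Rightarrow> real \<times> real) \<Rightarrow> bool" where
  "is_solution d \<gamma> \<alpha> x \<longleftrightarrow>
     (\<forall>t. x t \<in> Omega \<gamma> \<and>
        (x has_vector_derivative
           (G1 d \<gamma> \<alpha> (fst (x t)) (snd (x t)), G2 d \<gamma> \<alpha> (fst (x t)) (snd (x t)))) (at t))"

definition is_equilibrium :: "real \<Rightarrow> real \<Rightarrow> real \<Rightarrow> real \<times> real \<Rightarrow> bool" where
  "is_equilibrium d \<gamma> \<alpha> p \<longleftrightarrow>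
     p \<in> Omega \<gamma> \<and> G1 d \<gamma> \<alpha> (fst p) (snd p) = 0 \<and> G2 d \<gamma> \<alpha> (fst p) (snd p) = 0"

definition leapfrogging :: "real \<Rightarrow> real \<Rightarrow> real \<Rightarrow> (real \<Rightarrow> real \<times> real) \<Rightarrow> bool" where
  "leapfrogging d \<gamma> \<alpha> x \<longleftrightarrow>
     is_solution d \<gamma> \<alpha> x \<and>
     (\<exists>t s. x t \<noteq> x s) \<and>
     (\<exists>T>0. \<forall>t. x (t + T) = x t) \<and>
     range x \<subseteq> Omega \<gamma> \<and>
     (theta_g \<gamma>, 0) \<notin> range x \<and>
     bounded (connected_component_set (- range x) (theta_g \<gamma>, 0))"

end

theory Submission
  imports Defs
begin

text \<open>The system is Hamiltonian: the first component of the field is the \<open>W\<close>-derivative of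
  \<open>Gcal\<close> and the second is minus its \<open>\<theta>\<close>-derivative, so orbits lie on level sets of \<open>Gcal\<close>.
  Write \<open>h \<theta> = Gcal \<theta> 0\<close>, which dominates \<open>Gcal\<close> on every vertical line. It increases from
  \<open>-\<infinity>\<close> to \<open>\<infinity>\<close> on \<open>(0, theta_g)\<close>; to the right of \<open>theta_g\<close> the sign of its derivative is that
  of a strictly increasing function of \<open>tanh \<theta>\<close> minus a constant, so there \<open>h\<close> either decreases to its limit at
  infinity or has a unique minimum \<open>\<theta>s\<close>, the equilibrium.

  If an orbit encloses \<open>(theta_g, 0)\<close>, it meets both halves of the axis \<open>W = 0\<close>, since otherwise
  a ray would connect that point to infinity; hence the energy is a value of \<open>h\<close> to the right of \<open>theta_g\<close>.
  Conversely, an energy \<open>c\<close> that \<open>h\<close> takes at \<open>b > theta_g\<close> before reaching a critical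
  point confines the solution to a closed curve \<open>W\<^sup>2 = w \<theta>\<close> over some \<open>[a, b]\<close>. A solution there
  cannot converge, so it hits the axis infinitely often, and reflection in the axis combined with time
  reversal maps it to itself by uniqueness. This yields periodicity and that the orbit is the whole curve.\<close>

subsection \<open>Uniqueness for autonomous equations with a locally Lipschitz field\<close>

text \<open>Ball and constant may depend on the point: the vortex field has no uniform constant on
  \<open>Omega \<gamma>\<close>, being singular at \<open>(theta_g \<gamma>, 0)\<close> and as
  \<theta> tends to 0.\<close>

definition lipschitz_near :: "('a::metric_space \<Rightarrow> 'b::metric_space) \<Rightarrow> 'a \<Rightarrow> bool" where
  "lipschitz_near f p \<longleftrightarrow> (\<exists>r>0. \<exists>L. L-lipschitz_on (ball p r) f)"

lemma lipschitz_nearE2: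
  assumes "lipschitz_near f p" "lipschitz_near g p"
  obtains r L M where "r > 0" "L-lipschitz_on (ball p r) f" "M-lipschitz_on (ball p r) g"
proof -
  from assms obtain r1 r2 L M where *: "r1 > 0" "r2 > 0"
    "L-lipschitz_on (ball p r1) f" "M-lipschitz_on (ball p r2) g"
    unfolding lipschitz_near_def by blast
  show thesis
    by (rule that[of "min r1 r2" L M]) (use * in \<open>auto intro: lipschitz_on_subset\<close>)
qed

lemma lipschitz_near_bounded_linear:
  assumes "bounded_linear f"
  shows "lipschitz_near f p"
proof -
  interpret bounded_linear f by fact
  obtain B where "B-lipschitz_on (ball p 1) f"
    using lipschitz_boundE by blast
  then show ?thesis unfolding lipschitz_near_def by (intro exI[of _ 1]) auto
qed

lemma lipschitz_near_const: "lipschitz_near (\<lambda>x. c) p"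
  unfolding lipschitz_near_def by (metis lipschitz_on_constant zero_less_one)

lemma lipschitz_near_add:
  fixes f g :: "'a::metric_space \<Rightarrow> 'b::real_normed_vector"
  assumes "lipschitz_near f p" "lipschitz_near g p"
  shows "lipschitz_near (\<lambda>x. f x + g x) p"
proof -
  obtain r L M where "r > 0" "L-lipschitz_on (ball p r) f" "M-lipschitz_on (ball p r) g"
    by (rule lipschitz_nearE2[OF assms])
  then show ?thesis
    unfolding lipschitz_near_def using lipschitz_on_add by blast
qed

lemma lipschitz_near_Pair:
  assumes "lipschitz_near f p" "lipschitz_near g p"
  shows "lipschitz_near (\<lambda>x. (f x, g x)) p"
proof -
  obtain r L M where "r > 0" "L-lipschitz_on (ball p r) f" "M-lipschitz_on (ball p r) g"
    by (rule lipschitz_nearE2[OF assms])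
  then show ?thesis
    unfolding lipschitz_near_def using lipschitz_on_Pair by blast
qed

lemma lipschitz_near_compose:
  assumes f: "lipschitz_near f p" and g: "lipschitz_near g (f p)"
  shows "lipschitz_near (\<lambda>x. g (f x)) p"
proof -
  obtain r L where r: "r > 0" and L: "L-lipschitz_on (ball p r) f"
    using f unfolding lipschitz_near_def by blast
  obtain s M where s: "s > 0" and M: "M-lipschitz_on (ball (f p) s) g"
    using g unfolding lipschitz_near_def by blast
  have "continuous_on (ball p r) f"
    by (rule lipschitz_on_continuous_on[OF L])
  then have "isCont f p"
    using r by (simp add: continuous_on_eq_continuous_at)
  then obtain \<delta> where \<delta>: "\<delta> > 0" "\<And>x. dist x p < \<delta> \<Longrightarrow> dist (f x) (f p) < s"
    using s unfolding continuous_at_eps_delta by blast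
  have sub: "f ` ball p (min r \<delta>) \<subseteq> ball (f p) s"
    using \<delta>(2) by (auto simp: dist_commute)
  have "(M * L)-lipschitz_on (ball p (min r \<delta>)) (\<lambda>x. g (f x))"
    by (rule lipschitz_on_compose2)
      (use L M sub in \<open>auto intro: lipschitz_on_subset\<close>)
  then show ?thesis
    unfolding lipschitz_near_def using r \<delta>(1) by (metis min_less_iff_conj)
qed

lemma lipschitz_near_mult:
  fixes f g :: "'a::metric_space \<Rightarrow> real"
  assumes "lipschitz_near f p" "lipschitz_near g p"
  shows "lipschitz_near (\<lambda>x. f x * g x) p"
proof -
  obtain r L M where r: "r > 0" and L: "L-lipschitz_on (ball p r) f"
    and M: "M-lipschitz_on (ball p r) g"
    by (rule lipschitz_nearE2[OF assms])
  note L0 = lipschitz_on_nonneg[OF L] and M0 = lipschitz_on_nonneg[OF M]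
  \<comment> \<open>\<open>F\<close> and \<open>G\<close> bound the two factors on the ball: value
    at the centre plus the largest Lipschitz variation.\<close>
  define F where "F = \<bar>f p\<bar> + L * r"
  define G where "G = \<bar>g p\<bar> + M * r"
  have bound: "\<bar>u x\<bar> \<le> \<bar>u p\<bar> + K * r"
    if "K-lipschitz_on (ball p r) u" "x \<in> ball p r" for u :: "'a \<Rightarrow> real" and K x
  proof -
    have "dist (u x) (u p) \<le> K * dist x p"
      using that r by (auto intro: lipschitz_onD)
    also have "\<dots> \<le> K * r"
      using that lipschitz_on_nonneg[OF that(1)]
      by (auto intro!: mult_left_mono simp: dist_commute)
    finally show ?thesis by (simp add: dist_real_def)
  qed
  have "(F * M + L * G)-lipschitz_on (ball p r) (\<lambda>x. f x * g x)"
  proof (rule lipschitz_onI)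
    fix x y assume x: "x \<in> ball p r" and y: "y \<in> ball p r"
    have "dist (f x * g x) (f y * g y) = \<bar>f x * (g x - g y) + (f x - f y) * g y\<bar>"
      by (simp add: dist_real_def algebra_simps)
    also have "\<dots> \<le> \<bar>f x\<bar> * \<bar>g x - g y\<bar> + \<bar>f x - f y\<bar> * \<bar>g y\<bar>"
      by (metis abs_mult abs_triangle_ineq)
    also have "\<dots> \<le> F * (M * dist x y) + (L * dist x y) * G"
      using bound[OF L x] bound[OF M y] lipschitz_onD[OF L x y] lipschitz_onD[OF M x y] L0 M0 r
      unfolding F_def G_def dist_real_def
      by (intro add_mono mult_mono) auto
    also have "\<dots> = (F * M + L * G) * dist x y" by (simp add: algebra_simps)
    finally show "dist (f x * g x) (f y * g y) \<le> (F * M + L * G) * dist x y" .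
  next
    show "0 \<le> F * M + L * G"
      using L0 M0 r unfolding F_def G_def by auto
  qed
  then show ?thesis
    unfolding lipschitz_near_def using r by blast
qed

text \<open>On a compact ball around \<open>y\<close> inside \<open>S\<close> the continuous
  derivative is bounded, and the bound serves as a Lipschitz constant.\<close>

lemma lipschitz_near_C1_real:
  fixes g :: "real \<Rightarrow> real"
  assumes "open S" "y \<in> S"
    and der: "\<And>u. u \<in> S \<Longrightarrow> (g has_real_derivative g' u) (at u)"
    and cont: "continuous_on S g'"
  shows "lipschitz_near g y"
proof -
  obtain e where e: "e > 0" "cball y e \<subseteq> S"
    using assms open_contains_cball by blast
  have "bounded (g' ` cball y e)"
    using cont e(2) compact_cball
    by (meson compact_continuous_image compact_imp_bounded continuous_on_subset)
  then obtain B where B: "\<And>u. u \<in> cball y e \<Longrightarrow> \<bar>g' u\<bar> \<le> B" and "B > 0"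
    unfolding bounded_pos by (metis imageI real_norm_def)
  have "B-lipschitz_on (ball y e) g"
  proof (rule bounded_derivative_imp_lipschitz)
    fix u assume "u \<in> ball y e"
    then have u: "u \<in> cball y e" by auto
    then have "(g has_real_derivative g' u) (at u within ball y e)"
      using der e(2) by (meson has_field_derivative_at_within subsetD)
    then show "(g has_derivative (*) (g' u)) (at u within ball y e)"
      by (simp add: has_field_derivative_def)
    show "onorm ((*) (g' u)) \<le> B"
      by (rule onorm_le) (use B[OF u] in \<open>auto simp: abs_mult intro: mult_right_mono\<close>)
  qed (use \<open>B > 0\<close> in auto)
  then show ?thesis
    unfolding lipschitz_near_def using e by blast
qed

text \<open>The set of agreement times is closed by continuity. It is open because near such a time
  both solutions stay in one Lipschitz ball, where a short-time contraction estimate forces their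
  difference to vanish. Connectedness of the line concludes.\<close>

lemma autonomous_ode_unique:
  fixes f :: "'a::real_normed_vector \<Rightarrow> 'a"
  assumes lip: "\<And>p. p \<in> S \<Longrightarrow> lipschitz_near f p"
    and xS: "\<And>t. x t \<in> S"
    and x': "\<And>t. (x has_vector_derivative f (x t)) (at t)"
    and y': "\<And>t. (y has_vector_derivative f (y t)) (at t)"
    and eq: "x s = y s"
  shows "x t = y t"
proof -
  define Z where "Z = {t. x t = y t}"
  have cx: "continuous_on UNIV x" and cy: "continuous_on UNIV y"
    using x' y' by (auto intro!: continuous_at_imp_continuous_on has_vector_derivative_continuous)
  have "closed Z"
    unfolding Z_def using cx cy by (rule closed_Collect_eq)
  moreover have "open Z"
    unfolding open_contains_cball
  proof
    fix t1 assume "t1 \<in> Z"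
    then have xy: "y t1 = x t1" by (simp add: Z_def)
    obtain r L0 where r: "r > 0" and L0: "L0-lipschitz_on (ball (x t1) r) f"
      using lip[OF xS] unfolding lipschitz_near_def by blast
    \<comment> \<open>Raising the constant to at least 1 makes the division by \<open>L\<close> in
      \<open>\<delta>\<close> meaningful.\<close>
    define L where "L = max L0 1"
    have L: "L-lipschitz_on (ball (x t1) r) f" and L1: "L \<ge> 1"
      using lipschitz_on_mono[OF L0, of _ L] by (auto simp: L_def)
    obtain e1 where e1: "e1 > 0" "\<And>u. dist u t1 < e1 \<Longrightarrow> dist (x u) (x t1) < r"
      using cx r unfolding continuous_on_iff by (metis UNIV_I)
    obtain e2 where e2: "e2 > 0" "\<And>u. dist u t1 < e2 \<Longrightarrow> dist (y u) (x t1) < r"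
      using cy r unfolding continuous_on_iff by (metis UNIV_I xy)
    \<comment> \<open>Within \<open>\<delta>\<close> of \<open>t1\<close> both solutions lie in the
      ball, and \<open>L * \<delta> \<le> 1/2\<close> makes the estimate contracting.\<close>
    define \<delta> where "\<delta> = min (min (e1/2) (e2/2)) (1 / (2 * L))"
    have \<delta>: "\<delta> > 0" "\<delta> < e1" "\<delta> < e2" "L * \<delta> \<le> 1/2"
    proof -
      show "\<delta> > 0" "\<delta> < e1" "\<delta> < e2" using e1 e2 L1 by (auto simp: \<delta>_def)
      have "L * \<delta> \<le> L * (1 / (2*L))" using L1 by (intro mult_left_mono) (auto simp: \<delta>_def)
      then show "L * \<delta> \<le> 1/2" using L1 by simp
    qed
    define K where "K = cball t1 \<delta>"
    define z where "z = (\<lambda>u. x u - y u)"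
    have in_ball: "x u \<in> ball (x t1) r" "y u \<in> ball (x t1) r" if "u \<in> K" for u
      using that e1(2)[of u] e2(2)[of u] \<delta> by (auto simp: K_def dist_commute)
    have "compact K" "K \<noteq> {}" using \<delta> by (auto simp: K_def)
    moreover have "continuous_on K (\<lambda>u. norm (z u))"
      unfolding z_def
      by (intro continuous_intros continuous_on_subset[OF cx] continuous_on_subset[OF cy]) auto
    ultimately obtain tm where tm: "tm \<in> K" "\<And>u. u \<in> K \<Longrightarrow> norm (z u) \<le> norm (z tm)"
      using continuous_attains_sup[of K "\<lambda>u. norm (z u)"] by blast
    \<comment> \<open>The mean value inequality bounds the largest difference, attained at
      \<open>tm\<close>, by half of itself, so it is 0.\<close>
    have "norm (z tm - z t1) \<le> (L * norm (z tm)) * norm (tm - t1)"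
    proof (rule differentiable_bound[where S=K and f'="\<lambda>u h. h *\<^sub>R (f (x u) - f (y u))"])
      show "convex K" "tm \<in> K" "t1 \<in> K" using tm \<delta> by (auto simp: K_def)
      fix u assume u: "u \<in> K"
      have "(z has_vector_derivative (f (x u) - f (y u))) (at u)"
        unfolding z_def by (intro derivative_intros x' y')
      then show "(z has_derivative (\<lambda>h. h *\<^sub>R (f (x u) - f (y u)))) (at u within K)"
        unfolding has_vector_derivative_def by (rule has_derivative_at_withinI)
      have "norm (f (x u) - f (y u)) \<le> L * norm (z u)"
        using lipschitz_onD[OF L in_ball[OF u]] by (simp add: z_def dist_norm)
      also have "\<dots> \<le> L * norm (z tm)"
        using tm(2)[OF u] L1 by (intro mult_left_mono) auto
      finally have "norm (f (x u) - f (y u)) \<le> L * norm (z tm)" .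
      then show "onorm (\<lambda>h. h *\<^sub>R (f (x u) - f (y u))) \<le> L * norm (z tm)"
        by (intro onorm_le) (metis abs_ge_zero mult.commute mult_left_mono norm_scaleR real_norm_def)
    qed
    also have "\<dots> \<le> (L * norm (z tm)) * \<delta>"
      using tm(1) L1 by (intro mult_left_mono) (auto simp: K_def dist_norm norm_minus_commute)
    also have "\<dots> = (L * \<delta>) * norm (z tm)" by simp
    also have "\<dots> \<le> 1/2 * norm (z tm)" using \<delta> by (intro mult_right_mono) auto
    finally have "norm (z tm) \<le> 0" using xy by (simp add: z_def)
    then have "K \<subseteq> Z"
      using tm(2) unfolding Z_def z_def by force
    then show "\<exists>e>0. cball t1 e \<subseteq> Z" using \<delta> unfolding K_def by blast
  qed
  ultimately have "Z = UNIV"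
    using eq connected_UNIV[where 'a=real] unfolding connected_clopen Z_def
    by fastforce
  then show ?thesis by (auto simp: Z_def)
qed

subsection \<open>Limits, rays and regions under a graph\<close>

text \<open>The limit is the infimum of \<open>u\<close> over the times after
  \<open>t0\<close>.\<close>

lemma antimono_bounded_tendsto_at_top:
  fixes u :: "real \<Rightarrow> real"
  assumes anti: "\<And>s t. t0 < s \<Longrightarrow> s \<le> t \<Longrightarrow> u t \<le> u s"
    and bound: "\<And>t. B \<le> u t"
  shows "\<exists>l. (u \<longlongrightarrow> l) at_top"
proof -
  define l where "l = (INF t\<in>{t0<..}. u t)"
  have bdd: "bdd_below (u ` {t0<..})"
    using bound by (auto intro!: bdd_belowI)
  have "(u \<longlongrightarrow> l) at_top"
  proof (rule order_tendstoI)
    fix c assume "c < l"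
    moreover have "l \<le> u t" if "t > t0" for t
      unfolding l_def using bdd that by (intro cINF_lower) auto
    ultimately show "\<forall>\<^sub>F t in at_top. c < u t"
      by (intro eventually_mono[OF eventually_gt_at_top[of t0]]) force
  next
    fix c assume "l < c"
    then obtain s where s: "s > t0" "u s < c"
      unfolding l_def using cINF_less_iff[of "{t0<..}" u c] bdd by auto
    then show "\<forall>\<^sub>F t in at_top. u t < c"
      by (intro eventually_mono[OF eventually_ge_at_top[of s]]) (use anti in force)
  qed
  then show ?thesis ..
qed

text \<open>The unit increments \<open>u (t + 1) - u t\<close> tend to 0, but by the mean value
  theorem each is a value of \<open>u'\<close> at a later time and hence close to
  \<open>m\<close>.\<close>

lemma derivative_limit_eq_0:
  fixes u :: "real \<Rightarrow> real"
  assumes u: "(u \<longlongrightarrow> l) at_top"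
    and der: "\<And>t. (u has_real_derivative u' t) (at t)"
    and u': "(u' \<longlongrightarrow> m) at_top"
  shows "m = 0"
proof (rule ccontr)
  assume "m \<noteq> 0"
  have "((\<lambda>t. u (t + 1)) \<longlongrightarrow> l) at_top"
    by (rule filterlim_compose[OF u]) (rule filterlim_tendsto_add_at_top[OF tendsto_const filterlim_ident, of 1, simplified add.commute])
  then have "((\<lambda>t. u (t + 1) - u t) \<longlongrightarrow> l - l) at_top"
    by (intro tendsto_diff u)
  then have "\<forall>\<^sub>F t in at_top. \<bar>u (t + 1) - u t\<bar> < \<bar>m\<bar> / 2"
    using \<open>m \<noteq> 0\<close> by (auto dest!: tendstoD[where e="\<bar>m\<bar>/2"] simp: dist_real_def)
  moreover obtain N where N: "\<And>t. t \<ge> N \<Longrightarrow> \<bar>u' t - m\<bar> < \<bar>m\<bar> / 2"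
    using tendstoD[OF u', of "\<bar>m\<bar>/2"] \<open>m \<noteq> 0\<close>
    by (auto simp: eventually_at_top_linorder dist_real_def)
  ultimately have "\<forall>\<^sub>F t in at_top. t \<ge> N \<and> \<bar>u (t + 1) - u t\<bar> < \<bar>m\<bar> / 2"
    by (intro eventually_conj[OF eventually_ge_at_top])
  then obtain t where t: "t \<ge> N" "\<bar>u (t + 1) - u t\<bar> < \<bar>m\<bar> / 2"
    using eventually_happens'[OF trivial_limit_at_top_linorder] by blast
  obtain z where "z > t" "u (t + 1) - u t = u' z"
    using MVT2[of t "t + 1" u u'] der by auto
  then show False using N[of z] t by linarith
qed

text \<open>A ray missing \<open>R\<close> would be a connected unbounded set inside the
  component.\<close>

lemma ray_meets_if_bounded_component:
  fixes p v :: "'a::real_normed_vector"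
  assumes bdd: "bounded (connected_component_set (- R) p)" and "v \<noteq> 0"
  shows "\<exists>t\<ge>0. p + t *\<^sub>R v \<in> R"
proof (rule ccontr)
  assume neg: "\<not> ?thesis"
  define ray where "ray = (\<lambda>t. p + t *\<^sub>R v) ` {0..}"
  have "connected ray"
    unfolding ray_def by (intro connected_continuous_image continuous_intros) auto
  moreover have "p \<in> ray" "ray \<subseteq> - R"
    using neg unfolding ray_def by (force, auto)
  ultimately have "ray \<subseteq> connected_component_set (- R) p"
    by (intro connected_component_maximal)
  then obtain B where B: "\<And>q. q \<in> ray \<Longrightarrow> norm q \<le> B"
    using bdd by (meson bounded_iff bounded_subset)
  \<comment> \<open>Chosen so that \<open>t *\<^sub>R v\<close> has norm
    \<open>\<bar>B\<bar> + norm p + 1\<close>, which puts the ray point outside the bound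
    \<open>B\<close>.\<close>
  define t where "t = (\<bar>B\<bar> + norm p + 1) / norm v"
  have "t \<ge> 0" by (simp add: t_def)
  then have "norm (p + t *\<^sub>R v) \<le> B"
    by (intro B) (auto simp: ray_def)
  moreover have "norm (t *\<^sub>R v) = \<bar>B\<bar> + norm p + 1"
    using \<open>v \<noteq> 0\<close> \<open>t \<ge> 0\<close> by (simp add: t_def)
  moreover have "norm (t *\<^sub>R v) \<le> norm (p + t *\<^sub>R v) + norm p"
    by (metis add_diff_cancel_left' norm_triangle_ineq4)
  ultimately show False by linarith
qed

text \<open>The frontier of the region \<open>I\<close> between the two branches of the curve lies
  on the curve, so a connected set that starts in \<open>I\<close> and avoids the curve never leaves
  \<open>I\<close>, which is bounded.\<close>

lemma bounded_component_inside_graph: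
  fixes w :: "real \<Rightarrow> real"
  assumes "a \<le> b" and cont: "continuous_on {a..b} w" and "w a = 0" "w b = 0"
    and c: "c \<in> {a..b}" "w c > 0"
  shows "bounded (connected_component_set (- {(\<theta>, W). \<theta> \<in> {a..b} \<and> W\<^sup>2 = w \<theta>}) (c, 0))"
    (is "bounded (connected_component_set (- ?K) _)")
proof -
  \<comment> \<open>Clamping the argument extends \<open>w\<close> continuously to the line, which
    makes \<open>I\<close> open and \<open>J\<close> closed in the plane.\<close>
  define v where "v = (\<lambda>\<theta>. w (max a (min b \<theta>)))"
  have v: "v \<theta> = w \<theta>" if "\<theta> \<in> {a..b}" for \<theta>
    using that by (simp add: v_def)
  have cv: "continuous_on UNIV v"
    unfolding v_def by (rule continuous_on_compose2[OF cont])
      (use \<open>a \<le> b\<close> in \<open>auto intro!: continuous_intros\<close>)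
  have cv': "continuous_on UNIV (\<lambda>p::real\<times>real. v (fst p))"
    by (rule continuous_on_compose2[OF cv]) (auto intro!: continuous_intros)
  define I where "I = {p::real\<times>real. a < fst p \<and> fst p < b \<and> (snd p)\<^sup>2 < v (fst p)}"
  define J where "J = {p::real\<times>real. a \<le> fst p \<and> fst p \<le> b \<and> (snd p)\<^sup>2 \<le> v (fst p)}"
  have "open I"
    unfolding I_def by (intro open_Collect_conj open_Collect_less cv' continuous_intros)
  have "closed J"
    unfolding J_def by (intro closed_Collect_conj closed_Collect_le cv' continuous_intros)
  then have "closure I \<subseteq> J"
    by (intro closure_minimal) (auto simp: I_def J_def)
  \<comment> \<open>A point of \<open>J\<close> outside \<open>I\<close> either satisfies the
    equation of the curve or lies over \<open>a\<close> or \<open>b\<close>, where \<open>w\<close>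
    vanishes and forces the second coordinate to be 0.\<close>
  then have fr: "frontier I \<subseteq> ?K"
    using \<open>open I\<close> assms v unfolding frontier_def
    by (force simp: interior_open I_def J_def not_less)
  let ?C = "connected_component_set (- ?K) (c, 0)"
  have c': "a < c" "c < b" using c \<open>w a = 0\<close> \<open>w b = 0\<close>
    by (auto simp: less_le)
  then have cI: "(c, 0) \<in> I" using c v[of c] by (auto simp: I_def)
  have "(c, 0) \<notin> ?K" using c by auto
  then have "(c, 0) \<in> ?C" by (simp add: connected_component_refl)
  moreover have "?C \<inter> frontier I = {}"
    using fr connected_component_subset[of "- ?K" "(c, 0)"] by blast
  ultimately have "?C \<subseteq> I"
    using connected_Int_frontier[of ?C I] cI connected_connected_component by blast
  obtain B where B: "\<And>\<theta>. \<theta> \<in> {a..b} \<Longrightarrow> w \<theta> \<le> B"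
    using compact_continuous_image[OF cont] compact_imp_bounded bounded_imp_bdd_above
    unfolding bdd_above_def by (metis compact_Icc imageI)
  have "I \<subseteq> cbox (a, - sqrt B) (b, sqrt B)"
  proof
    fix p assume p: "p \<in> I"
    then have "(snd p)\<^sup>2 \<le> B" using B[of "fst p"] v[of "fst p"] by (auto simp: I_def)
    then have "\<bar>snd p\<bar> \<le> sqrt B" using real_le_rsqrt by (metis power2_abs)
    then show "p \<in> cbox (a, - sqrt B) (b, sqrt B)"
      using p by (cases p) (auto simp: I_def cbox_Pair_eq)
  qed
  then show ?thesis
    using \<open>?C \<subseteq> I\<close> bounded_cbox bounded_subset by blast
qed

subsection \<open>Planar fields reversible under reflection in the horizontal axis\<close>

text \<open>The parities \<open>odd\<close> and \<open>even\<close> make reflection in the axis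
  combined with time reversal a symmetry of the equation; \<open>neg\<close> makes the first
  coordinate strictly monotone off the axis.\<close>

locale reversible_field =
  fixes f1 f2 :: "real \<Rightarrow> real \<Rightarrow> real" and S :: "(real \<times> real) set"
  assumes lip: "\<And>p. p \<in> S \<Longrightarrow> lipschitz_near (\<lambda>p. (f1 (fst p) (snd p), f2 (fst p) (snd p))) p"
    and odd: "\<And>\<theta> W. f1 \<theta> (- W) = - f1 \<theta> W"
    and even: "\<And>\<theta> W. f2 \<theta> (- W) = f2 \<theta> W"
    and neg: "\<And>\<theta> W. (\<theta>, W) \<in> S \<Longrightarrow> W > 0 \<Longrightarrow> f1 \<theta> W < 0"
begin

definition solves :: "(real \<Rightarrow> real \<times> real) \<Rightarrow> bool" where
  "solves x \<longleftrightarrow> (\<forall>t. (x has_vector_derivative (f1 (fst (x t)) (snd (x t)), f2 (fst (x t)) (snd (x t)))) (at t))"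

lemma solvesD:
  assumes "solves x"
  shows "((\<lambda>t. fst (x t)) has_real_derivative f1 (fst (x t)) (snd (x t))) (at t)"
    and "((\<lambda>t. snd (x t)) has_real_derivative f2 (fst (x t)) (snd (x t))) (at t)"
  using assms unfolding solves_def has_real_derivative_iff_has_vector_derivative
  by (metis (no_types) bounded_linear.has_vector_derivative bounded_linear_fst fst_conv,
      metis (no_types) bounded_linear.has_vector_derivative bounded_linear_snd snd_conv)

lemma solvesI:
  assumes "\<And>t. ((\<lambda>t. fst (x t)) has_real_derivative f1 (fst (x t)) (snd (x t))) (at t)"
    and "\<And>t. ((\<lambda>t. snd (x t)) has_real_derivative f2 (fst (x t)) (snd (x t))) (at t)"
  shows "solves x"
  unfolding solves_def
proof
  fix t
  show "(x has_vector_derivative (f1 (fst (x t)) (snd (x t)), f2 (fst (x t)) (snd (x t)))) (at t)"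
    using has_vector_derivative_Pair[OF assms[of t, unfolded has_real_derivative_iff_has_vector_derivative]]
    by simp
qed

lemma solves_unique:
  assumes "solves x" "solves y" "\<And>t. x t \<in> S" "x s = y s"
  shows "x t = y t"
  by (rule autonomous_ode_unique[OF lip, of S x y s])
    (use assms in \<open>auto simp: solves_def\<close>)

text \<open>Time reversal contributes a factor -1. In the first component oddness of
  \<open>f1\<close> absorbs it, in the second it cancels against the reflected sign.\<close>

lemma solves_reflect:
  assumes "solves x"
  shows "solves (\<lambda>s. (fst (x (c - s)), - snd (x (c - s))))"
proof (rule solvesI, goal_cases)
  case (1 t)
  have "((\<lambda>s. c - s) has_real_derivative -1) (at t)"
    by (auto intro!: derivative_eq_intros)
  from DERIV_chain2[OF solvesD(1)[OF assms] this] show ?case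
    by (simp add: odd)
next
  case (2 t)
  have "((\<lambda>s. c - s) has_real_derivative -1) (at t)"
    by (auto intro!: derivative_eq_intros)
  from DERIV_minus[OF DERIV_chain2[OF solvesD(2)[OF assms] this]] show ?case
    by (simp add: even)
qed

lemma solves_continuous:
  assumes "solves x"
  shows "continuous_on A (\<lambda>t. fst (x t))" "continuous_on A (\<lambda>t. snd (x t))"
  using solvesD[OF assms]
  by (auto intro!: continuous_at_imp_continuous_on DERIV_isCont)

end

text \<open>The curve \<open>W\<^sup>2 = w \<theta>\<close> is symmetric about the axis and meets it
  only at \<open>(a, 0)\<close> and \<open>(b, 0)\<close>. There \<open>f1\<close> vanishes by
  oddness, so \<open>regular\<close> says that neither point is an equilibrium.\<close>

locale reversible_orbit = reversible_field +
  fixes w :: "real \<Rightarrow> real" and a b :: real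
  assumes ab: "a < b"
    and w_cont: "continuous_on {a..b} w"
    and w_ends: "w a = 0" "w b = 0"
    and w_pos: "\<And>\<theta>. a < \<theta> \<Longrightarrow> \<theta> < b \<Longrightarrow> w \<theta> > 0"
    and level_in: "\<And>\<theta> W. \<theta> \<in> {a..b} \<Longrightarrow> W\<^sup>2 = w \<theta> \<Longrightarrow> (\<theta>, W) \<in> S"
    and regular: "f2 a 0 \<noteq> 0" "f2 b 0 \<noteq> 0"
begin

definition level :: "(real \<times> real) set" where
  "level = {(\<theta>, W). \<theta> \<in> {a..b} \<and> W\<^sup>2 = w \<theta>}"

lemma w_zero_iff: "\<theta> \<in> {a..b} \<Longrightarrow> w \<theta> = 0 \<longleftrightarrow> \<theta> = a \<or> \<theta> = b"
  using w_pos[of \<theta>] w_ends by (auto simp: less_le)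

lemma level_subset: "level \<subseteq> S"
  using level_in by (auto simp: level_def)

lemma reflect_level: "(\<theta>, W) \<in> level \<Longrightarrow> (\<theta>, - W) \<in> level"
  by (auto simp: level_def)

lemma f1_zero_iff:
  assumes "(\<theta>, W) \<in> level"
  shows "f1 \<theta> W = 0 \<longleftrightarrow> W = 0"
proof -
  have "f1 \<theta> 0 = 0" using odd[of \<theta> 0] by simp
  moreover have "f1 \<theta> (- W) < 0" if "W < 0"
    using neg[of \<theta> "- W"] that reflect_level[OF assms] level_subset by auto
  moreover have "f1 \<theta> W < 0" if "W > 0"
    using neg[of \<theta> W] that assms level_subset by auto
  ultimately show ?thesis
    by (metis less_irrefl less_linear neg_0_equal_iff_equal odd)
qed

text \<open>A solution that stays off the axis is monotone in the first coordinate and hence converges; its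
  limit would be an equilibrium on the level set.\<close>

lemma meets_axis:
  assumes x: "solves x" and lev: "\<And>t. x t \<in> level"
  shows "\<exists>t>t0. snd (x t) = 0"
proof (rule ccontr)
  assume "\<not> ?thesis"
  then have nz: "\<And>t. t > t0 \<Longrightarrow> snd (x t) \<noteq> 0" by blast
  note D = solvesD[OF x] and C = solves_continuous[OF x]
  have inS: "(fst (x t), snd (x t)) \<in> S" for t using lev level_subset by auto
  have bnd: "a \<le> fst (x t)" "fst (x t) \<le> b" "(snd (x t))\<^sup>2 = w (fst (x t))" for t
    using lev[of t] by (auto simp: level_def)
  \<comment> \<open>The constant sign of the second coordinate after \<open>t0\<close>; multiplying
    by it treats both half planes at once.\<close>
  define \<sigma> where "\<sigma> = sgn (snd (x (t0 + 1)))"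
  have \<sigma>: "\<sigma> = 1 \<or> \<sigma> = -1" using nz[of "t0 + 1"] by (auto simp: \<sigma>_def sgn_real_def)
  have conn: "connected ((\<lambda>t. snd (x t)) ` {t0<..})"
    by (intro connected_continuous_image C) auto
  have sgn: "\<sigma> * snd (x t) > 0" if "t > t0" for t
  proof (rule ccontr)
    assume "\<not> 0 < \<sigma> * snd (x t)"
    moreover have "\<sigma> * snd (x (t0 + 1)) > 0"
      using nz[of "t0 + 1"] by (auto simp: \<sigma>_def sgn_real_def)
    ultimately have "0 \<in> (\<lambda>t. snd (x t)) ` {t0<..}"
      using connectedD_interval[OF conn, of "snd (x t)" "snd (x (t0 + 1))" 0]
        connectedD_interval[OF conn, of "snd (x (t0 + 1))" "snd (x t)" 0] \<sigma> that
      by (auto simp: not_less)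
    then show False using nz by auto
  qed
  have anti: "\<sigma> * fst (x t) \<le> \<sigma> * fst (x s)" if "t0 < s" "s \<le> t" for s t
  proof (rule DERIV_nonpos_imp_nonincreasing[OF that(2)])
    fix u assume u: "s \<le> u" "u \<le> t"
    have "\<sigma> * f1 (fst (x u)) (snd (x u)) \<le> 0"
      using sgn[of u] u that neg[OF inS, of u] \<sigma> 
        neg[of "fst (x u)" "- snd (x u)"] odd[of "fst (x u)" "snd (x u)"] level_subset
        reflect_level[of "fst (x u)" "snd (x u)"] lev[of u]
      by auto
    then show "\<exists>y. ((\<lambda>t. \<sigma> * fst (x t)) has_real_derivative y) (at u) \<and> y \<le> 0"
      using DERIV_cmult[OF D(1)] by blast
  qed
  have "- (\<bar>a\<bar> + \<bar>b\<bar>) \<le> \<sigma> * fst (x t)" for t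
    using bnd(1,2)[of t] \<sigma> by auto
  then obtain l' where "((\<lambda>t. \<sigma> * fst (x t)) \<longlongrightarrow> l') at_top"
    using antimono_bounded_tendsto_at_top[of t0 "\<lambda>t. \<sigma> * fst (x t)"] anti by blast
  \<comment> \<open>A second factor \<open>\<sigma>\<close> recovers the first coordinate, since
    \<open>\<sigma>\<close> squares to 1.\<close>
  then have "((\<lambda>t. \<sigma> * (\<sigma> * fst (x t))) \<longlongrightarrow> \<sigma> * l') at_top"
    by (intro tendsto_intros)
  then obtain l where l: "((\<lambda>t. fst (x t)) \<longlongrightarrow> l) at_top"
    using \<sigma> by (auto simp: mult.assoc[symmetric])
  have lab: "l \<in> {a..b}"
    using tendsto_lowerbound[OF l, of a] tendsto_upperbound[OF l, of b] bnd by auto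
  have "((\<lambda>t. w (fst (x t))) \<longlongrightarrow> w l) at_top"
    by (rule continuous_on_tendsto_compose[OF w_cont l lab]) (use bnd in auto)
  then have "((\<lambda>t. \<sigma> * sqrt (w (fst (x t)))) \<longlongrightarrow> \<sigma> * sqrt (w l)) at_top"
    by (intro tendsto_intros)
  \<comment> \<open>On the curve the sign determines the second coordinate from the first, so it
    converges as well.\<close>
  moreover have "\<forall>\<^sub>F t in at_top. \<sigma> * sqrt (w (fst (x t))) = snd (x t)"
  proof (rule eventually_mono[OF eventually_gt_at_top[of t0]])
    fix t assume "t0 < t"
    then show "\<sigma> * sqrt (w (fst (x t))) = snd (x t)"
      using sgn[of t] \<sigma> by (auto simp flip: bnd(3)[of t])
  qed
  ultimately have m: "((\<lambda>t. snd (x t)) \<longlongrightarrow> \<sigma> * sqrt (w l)) at_top" (is "(_ \<longlongrightarrow> ?m) _")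
    by (rule Lim_transform_eventually)
  have "w l \<ge> 0" using w_zero_iff[OF lab] w_pos[of l] lab by (cases "l = a \<or> l = b") auto
  then have lm: "(l, ?m) \<in> level"
    using lab \<sigma> by (auto simp: level_def power_mult_distrib)
  obtain r L where r: "r > 0" "L-lipschitz_on (ball (l, ?m) r) (\<lambda>p. (f1 (fst p) (snd p), f2 (fst p) (snd p)))"
    using lip[of "(l, ?m)"] lm level_subset unfolding lipschitz_near_def by blast
  then have ic: "isCont (\<lambda>p. (f1 (fst p) (snd p), f2 (fst p) (snd p))) (l, ?m)"
    using lipschitz_on_continuous_on[OF r(2)] by (simp add: continuous_on_eq_continuous_at)
  have "(x \<longlongrightarrow> (l, ?m)) at_top"
    using tendsto_Pair[OF l m] by simp
  from isCont_tendsto_compose[OF ic this]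
  have lim: "((\<lambda>t. (f1 (fst (x t)) (snd (x t)), f2 (fst (x t)) (snd (x t)))) \<longlongrightarrow> (f1 l ?m, f2 l ?m)) at_top"
    by simp
  \<comment> \<open>Both components of the field vanish at the limit point. The first puts it on the
    axis, hence at an end point, where the second contradicts \<open>regular\<close>.\<close>
  have "f1 l ?m = 0"
    by (rule derivative_limit_eq_0[OF l D(1)]) (use tendsto_fst[OF lim] in simp)
  then have m0: "?m = 0" using f1_zero_iff[OF lm] by simp
  have "f2 l ?m = 0"
    by (rule derivative_limit_eq_0[OF m D(2)]) (use tendsto_snd[OF lim] in simp)
  moreover have "l = a \<or> l = b"
    using m0 \<sigma> w_zero_iff[OF lab] by auto
  ultimately show False using m0 regular by auto
qed

text \<open>The reflected and time-reversed solution agrees with \<open>x\<close> at time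
  \<open>c\<close>, where the second coordinate is 0, so uniqueness identifies the two.\<close>

lemma reflect_solution:
  assumes "solves x" "\<And>t. x t \<in> level" "snd (x c) = 0"
  shows "x (2 * c - t) = (fst (x t), - snd (x t))"
proof -
  let ?y = "\<lambda>s. (fst (x (2 * c - s)), - snd (x (2 * c - s)))"
  have "x s = ?y s" for s
    by (rule solves_unique[OF assms(1) solves_reflect[OF assms(1), of "2 * c"], of c])
      (use assms level_subset in \<open>auto intro!: prod_eqI\<close>)
  from this[of "2 * c - t"] show ?thesis by simp
qed

text \<open>Between consecutive axis hits \<open>t1\<close> and \<open>t2\<close> the first
  coordinate passes from one end of \<open>{a..b}\<close> to the other; reflection at
  \<open>t1\<close> supplies the opposite arc. The reflections at \<open>t1\<close> and
  \<open>t2\<close> compose to a time shift, which is the period.\<close>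

lemma closed_orbit:
  assumes x: "solves x" and lev: "\<And>t. x t \<in> level"
  shows "range x = level" and "\<exists>T>0. \<forall>t. x (t + T) = x t"
proof -
  note D = solvesD[OF x] and C = solves_continuous[OF x]
  have bnd: "fst (x t) \<in> {a..b}" "(snd (x t))\<^sup>2 = w (fst (x t))" for t
    using lev[of t] by (auto simp: level_def)
  \<comment> \<open>A solution staying on the axis would sit at an end point with zero derivative of
    the second coordinate, against \<open>regular\<close>.\<close>
  obtain t where t: "snd (x t) \<noteq> 0"
  proof (rule ccontr)
    assume "\<not> thesis"
    then have z: "snd (x s) = 0" for s using that by blast
    then have "f2 (fst (x 0)) 0 = 0"
      using D(2)[of 0] DERIV_const[of 0 "at 0"] by (simp add: DERIV_unique)
    moreover have "fst (x 0) = a \<or> fst (x 0) = b"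
      using w_zero_iff[OF bnd(1)] bnd(2)[of 0] z by simp
    ultimately show False using regular by auto
  qed
  obtain t3 where t3: "t3 > t" "snd (x t3) = 0" using meets_axis[OF x lev] by blast
  \<comment> \<open>An axis hit before \<open>t\<close> comes from \<open>meets_axis\<close> applied
    to the time-reversed reflection.\<close>
  have "(fst (x (0 - s)), - snd (x (0 - s))) \<in> level" for s
    using lev by (intro reflect_level) simp
  then obtain t0' where "t0' > - t" "- snd (x (0 - t0')) = 0"
    using meets_axis[OF solves_reflect[OF x, of 0], of "- t"] by auto
  then obtain t0 where t0: "t0 < t" "snd (x t0) = 0"
    by (metis add.inverse_neutral diff_0 minus_equation_iff minus_less_iff)
  \<comment> \<open>Closedness of the zero set yields the first zero \<open>t2\<close> after
    \<open>t\<close> and the last zero \<open>t1\<close> before it.\<close>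
  have cl: "closed {s. snd (x s) = 0}"
    using closed_Collect_eq[OF C(2) continuous_on_const, of 0] by simp
  have "compact ({s. snd (x s) = 0} \<inter> {t..t3})" "{s. snd (x s) = 0} \<inter> {t..t3} \<noteq> {}"
    using cl t3 by (auto intro: closed_Int_compact)
  then obtain t2 where t2: "snd (x t2) = 0" "t2 \<ge> t" "t2 \<le> t3"
    "\<And>s. snd (x s) = 0 \<Longrightarrow> t \<le> s \<Longrightarrow> s \<le> t3 \<Longrightarrow> t2 \<le> s"
    using compact_attains_inf[of "{s. snd (x s) = 0} \<inter> {t..t3}"] by force
  have "compact ({s. snd (x s) = 0} \<inter> {t0..t})" "{s. snd (x s) = 0} \<inter> {t0..t} \<noteq> {}"
    using cl t0 by (auto intro: closed_Int_compact)
  then obtain t1 where t1: "snd (x t1) = 0" "t0 \<le> t1" "t1 \<le> t"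
    "\<And>s. snd (x s) = 0 \<Longrightarrow> t0 \<le> s \<Longrightarrow> s \<le> t \<Longrightarrow> s \<le> t1"
    using compact_attains_sup[of "{s. snd (x s) = 0} \<inter> {t0..t}"] by force
  have ne: "snd (x s) \<noteq> 0" if "t1 < s" "s < t2" for s
    using t1(2) t1(4)[of s] t2(3) t2(4)[of s] that by linarith
  have "t1 < t2" using t1 t2 t by (metis order_antisym order_trans not_le)
  \<comment> \<open>Since \<open>f1\<close> is nonzero strictly between the hits, the mean value
    theorem separates the two first coordinates: one is \<open>a\<close>, the other
    \<open>b\<close>.\<close>
  then obtain z where z: "t1 < z" "z < t2"
    "fst (x t2) - fst (x t1) = (t2 - t1) * f1 (fst (x z)) (snd (x z))"
    using MVT2[of t1 t2 "\<lambda>t. fst (x t)" "\<lambda>t. f1 (fst (x t)) (snd (x t))"] D(1) by blast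
  then have "fst (x t1) \<noteq> fst (x t2)"
    using ne[of z] f1_zero_iff[of "fst (x z)" "snd (x z)"] lev[of z] by auto
  moreover have "fst (x t1) = a \<or> fst (x t1) = b" "fst (x t2) = a \<or> fst (x t2) = b"
    using w_zero_iff[OF bnd(1)] bnd(2)[of t1] bnd(2)[of t2] t1 t2 by simp_all
  moreover have conn: "connected ((\<lambda>t. fst (x t)) ` {t1..t2})"
    by (intro connected_continuous_image C) auto
  ultimately have surj: "\<exists>s. fst (x s) = l" if "l \<in> {a..b}" for l
    using connectedD_interval[OF conn, of "fst (x t1)" "fst (x t2)" l]
      connectedD_interval[OF conn, of "fst (x t2)" "fst (x t1)" l] that \<open>t1 < t2\<close> by force
  note refl1 = reflect_solution[OF x lev t1(1)] and refl2 = reflect_solution[OF x lev t2(1)]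
  show "range x = level"
  proof
    show "range x \<subseteq> level" using lev by auto
    show "level \<subseteq> range x"
    proof
      fix p assume p: "p \<in> level"
      then obtain s where s: "fst (x s) = fst p" using surj[of "fst p"] by (auto simp: level_def)
      then have "(snd (x s))\<^sup>2 = (snd p)\<^sup>2"
        using bnd(2)[of s] p by (auto simp: level_def)
      then have "snd p = snd (x s) \<or> snd p = - snd (x s)"
        by (metis power2_eq_iff)
      then have "p = x s \<or> p = x (2 * t1 - s)"
        using s refl1[of s] by (metis prod.collapse)
      then show "p \<in> range x" by blast
    qed
  qed
  have "x (s + 2 * (t2 - t1)) = x s" for s
    using refl2[of "2 * t1 - s"] refl1[of s] by (simp add: algebra_simps)
  then show "\<exists>T>0. \<forall>t. x (t + T) = x t"
    using \<open>t1 < t2\<close> by (intro exI[of _ "2 * (t2 - t1)"]) auto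
qed

end

subsection \<open>The vortex pair\<close>

lemma tanh_artanh_real:
  fixes x :: real
  assumes "-1 < x" "x < 1"
  shows "tanh (artanh x) = x"
proof -
  define z where "z = (1 + x) / (1 - x)"
  have z: "z > 0" using assms by (simp add: z_def)
  have "artanh x = ln (sqrt z)"
    using z by (simp add: artanh_def z_def[symmetric] ln_sqrt)
  then have "tanh (artanh x) = (z - 1) / (z + 1)"
    using z by (simp add: tanh_ln_real)
  also have "\<dots> = x" using assms by (simp add: z_def field_simps)
  finally show ?thesis .
qed

lemma powr_three_halves: "0 \<le> u \<Longrightarrow> u powr (3/2) = sqrt u ^ 3" for u :: real
proof -
  assume "0 \<le> u"
  have "u powr (3/2) = (u powr (1/2)) powr 3"
    by (simp add: powr_powr)
  also have "\<dots> = sqrt u ^ 3"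
    using \<open>0 \<le> u\<close> by (cases "u = 0") (simp_all add: powr_half_sqrt powr_numeral)
  finally show ?thesis .
qed

locale vortex =
  fixes d \<gamma> \<alpha> :: real
  assumes d: "d > 0" and \<gamma>: "\<gamma> > 1" and \<alpha>: "\<alpha> > 0"
begin

definition k where "k = sqrt \<gamma>"
text \<open>The signed difference of the two filament radii, so that \<open>E\<close> becomes
  \<open>(gap \<theta>)\<^sup>2 + W\<^sup>2\<close>, the squared distance of the filaments in a
  meridian half plane.\<close>

definition gap where "gap \<theta> = sqrt d / k * (cosh \<theta> - k * sinh \<theta>)"
definition gap' where "gap' \<theta> = sqrt d / k * (sinh \<theta> - k * cosh \<theta>)"
text \<open>The part of the Hamiltonian independent of \<open>W\<close>; the remaining summand is
  the interaction term, inversely proportional to the distance.\<close>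

definition pot where
  "pot \<theta> = (1 / sqrt d) * (2 * k ^ 3 * arctan (tanh (\<theta> / 2)) + ln (tanh (\<theta> / 2)))"
definition pot' where "pot' \<theta> = (1 / sqrt d) * (k ^ 3 / cosh \<theta> + 1 / sinh \<theta>)"
text \<open>The limit of \<open>pot\<close>, and of \<open>h\<close>, at infinity: the energy
  threshold when there is no equilibrium.\<close>

definition pot_sup where "pot_sup = pi * k ^ 3 / (2 * sqrt d)"
definition h where "h \<theta> = pot \<theta> + \<alpha> * k / \<bar>gap \<theta>\<bar>"

abbreviation "\<theta>g \<equiv> theta_g \<gamma>"
abbreviation "field1 \<equiv> G1 d \<gamma> \<alpha>"
abbreviation "field2 \<equiv> G2 d \<gamma> \<alpha>"

section \<open>The field and the Hamiltonian in terms of \<open>gap\<close> and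
  \<open>pot\<close>\<close>

lemma k: "k > 1" "k > 0" "k\<^sup>2 = \<gamma>" "sqrt \<gamma> = k" "\<gamma> powr (3/2) = k ^ 3"
  using \<gamma> by (auto simp: k_def powr_three_halves)

lemma tanh_theta_g: "tanh \<theta>g = 1 / k"
  using k by (simp add: theta_g_def tanh_artanh_real less_trans[of "-1" 0])

lemma theta_g_pos: "\<theta>g > 0"
  using tanh_theta_g k by (metis tanh_real_pos_iff zero_less_divide_1_iff)

text \<open>As \<open>tanh \<theta>g = 1 / k\<close>, factoring out \<open>k * cosh \<theta>\<close>
  reduces the sign of \<open>gap\<close> to the monotonicity of tanh.\<close>

lemma cosh_minus_k_sinh: "cosh \<theta> - k * sinh \<theta> = k * cosh \<theta> * (tanh \<theta>g - tanh \<theta>)"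
  unfolding tanh_theta_g using k by (simp add: tanh_def field_simps)

lemma gap_sign:
  "gap \<theta> > 0 \<longleftrightarrow> \<theta> < \<theta>g" "gap \<theta> < 0 \<longleftrightarrow> \<theta> > \<theta>g" "gap \<theta> = 0 \<longleftrightarrow> \<theta> = \<theta>g"
proof -
  define K where "K = sqrt d * cosh \<theta>"
  have "K > 0" using d by (simp add: K_def)
  moreover have "gap \<theta> = K * (tanh \<theta>g - tanh \<theta>)"
    using k by (simp add: gap_def cosh_minus_k_sinh K_def)
  ultimately show "gap \<theta> > 0 \<longleftrightarrow> \<theta> < \<theta>g" "gap \<theta> < 0 \<longleftrightarrow> \<theta> > \<theta>g" "gap \<theta> = 0 \<longleftrightarrow> \<theta> = \<theta>g"
    by (auto simp: zero_less_mult_iff mult_less_0_iff)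
qed

lemma gap_deriv: "(gap has_real_derivative gap' \<theta>) (at \<theta>)"
  unfolding gap_def[abs_def] gap'_def using k by (auto intro!: derivative_eq_intros)

lemma gap'_neg: "gap' \<theta> < 0"
proof -
  have "sinh \<theta> < 1 * cosh \<theta>" by (simp add: sinh_less_cosh_real)
  also have "\<dots> \<le> k * cosh \<theta>" using k by (intro mult_right_mono) auto
  finally show ?thesis using d k by (simp add: gap'_def mult_pos_neg divide_neg_pos)
qed

lemma gap_strict_antimono: "s < t \<Longrightarrow> gap t < gap s"
  by (rule DERIV_neg_imp_decreasing) (use gap_deriv gap'_neg in blast)+

lemma E_eq: "E d \<gamma> \<theta> W = (gap \<theta>)\<^sup>2 + W\<^sup>2"
  using d k by (simp add: E_def gap_def power_mult_distrib power_divide)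

lemma E_pos: "(\<theta>, W) \<in> Omega \<gamma> \<Longrightarrow> (gap \<theta>)\<^sup>2 + W\<^sup>2 > 0"
  using gap_sign(3)[of \<theta>] by (auto simp: Omega_def sum_power2_gt_zero_iff)

lemma gap_gap': "gap \<theta> * gap' \<theta> = d / \<gamma> * (sinh \<theta> - k * cosh \<theta>) * (cosh \<theta> - k * sinh \<theta>)"
proof -
  have "gap \<theta> * gap' \<theta> = (sqrt d)\<^sup>2 / k\<^sup>2 * (sinh \<theta> - k * cosh \<theta>) * (cosh \<theta> - k * sinh \<theta>)"
    by (simp add: gap_def gap'_def power2_eq_square)
  then show ?thesis using d k by simp
qed

lemma field1_eq: "field1 \<theta> W = - (\<alpha> * k * W / sqrt ((gap \<theta>)\<^sup>2 + W\<^sup>2) ^ 3)"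
  by (simp add: G1_def E_eq powr_three_halves k)

lemma field2_eq: "field2 \<theta> W = - pot' \<theta> + \<alpha> * k * (gap \<theta> * gap' \<theta>) / sqrt ((gap \<theta>)\<^sup>2 + W\<^sup>2) ^ 3"
proof -
  define X where "X = (sinh \<theta> - k * cosh \<theta>) * (cosh \<theta> - k * sinh \<theta>)"
  define R where "R = sqrt ((gap \<theta>)\<^sup>2 + W\<^sup>2) ^ 3"
  have "\<alpha> * k * (gap \<theta> * gap' \<theta>) = \<alpha> * (k * d / k\<^sup>2) * X"
    unfolding gap_gap' X_def k(3) by simp
  also have "k * d / k\<^sup>2 = d / k"
    using k(2) by (simp add: power2_eq_square)
  finally have "\<alpha> * k * (gap \<theta> * gap' \<theta>) / R = \<alpha> * d * X / (k * R)" by simp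
  moreover have "field2 \<theta> W = - pot' \<theta> + \<alpha> * d * X / (k * R)"
    unfolding G2_def E_eq k(4,5) pot'_def X_def R_def by (simp add: powr_three_halves)
  ultimately show ?thesis by (simp add: R_def)
qed

lemma Gcal_eq: "Gcal d \<gamma> \<alpha> \<theta> W = pot \<theta> + \<alpha> * k / sqrt ((gap \<theta>)\<^sup>2 + W\<^sup>2)"
  by (simp add: Gcal_def E_eq powr_half_sqrt pot_def k)

section \<open>The energy on the axis: bounds, limits and attained values\<close>

lemma Gcal_axis: "Gcal d \<gamma> \<alpha> \<theta> 0 = h \<theta>"
  by (simp add: Gcal_eq h_def)

text \<open>\<open>W\<close> enters only through the distance, which is least on the axis. At
  \<open>\<theta>g\<close> the gap is 0 and division by zero gives \<open>h\<close> the value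
  \<open>pot \<theta>g\<close>, so that point is excluded.\<close>

lemma Gcal_le_h:
  assumes "\<theta> \<noteq> \<theta>g"
  shows "Gcal d \<gamma> \<alpha> \<theta> W \<le> h \<theta>"
proof -
  have "\<bar>gap \<theta>\<bar> \<le> sqrt ((gap \<theta>)\<^sup>2 + W\<^sup>2)"
    by (metis real_sqrt_abs real_sqrt_le_mono le_add_same_cancel1 zero_le_power2)
  then show ?thesis
    unfolding Gcal_eq h_def using assms gap_sign(3)[of \<theta>] \<alpha> k
    by (intro add_left_mono divide_left_mono mult_pos_pos) (auto simp: add_pos_nonneg)
qed

text \<open>With \<open>S\<close> and \<open>C\<close> at the half argument, the double-argument
  formulas turn the derivative of the arctan term into \<open>1 / (2 * cosh \<theta>)\<close> and
  that of the ln term into \<open>1 / sinh \<theta>\<close>.\<close>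

lemma pot_deriv:
  assumes "\<theta> > 0"
  shows "(pot has_real_derivative pot' \<theta>) (at \<theta>)"
proof -
  define S where "S = sinh (\<theta>/2)"
  define C where "C = cosh (\<theta>/2)"
  have pos: "S > 0" "C > 0" using assms by (auto simp: S_def C_def)
  have th: "tanh (\<theta>/2) = S / C" by (simp add: S_def C_def tanh_def)
  have double: "sinh \<theta> = 2 * S * C" "cosh \<theta> = C\<^sup>2 + S\<^sup>2"
    using sinh_double[of "\<theta>/2"] cosh_double[of "\<theta>/2"] by (simp_all add: S_def C_def)
  have py: "C\<^sup>2 - S\<^sup>2 = 1" using hyperbolic_pythagoras[of "\<theta>/2"] by (simp add: S_def C_def)
  have t': "1 - (S/C)\<^sup>2 = 1 / C\<^sup>2" using py pos by (simp add: divide_simps)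
  have t: "((\<lambda>\<theta>. tanh (\<theta>/2)) has_real_derivative (1 - (S/C)\<^sup>2) * (1/2)) (at \<theta>)"
    unfolding th[symmetric] by (auto intro!: derivative_eq_intros)
  have "((\<lambda>\<theta>. arctan (tanh (\<theta>/2))) has_real_derivative (1 - (S/C)\<^sup>2) * (1/2) / (1 + (S/C)\<^sup>2)) (at \<theta>)"
    by (rule DERIV_cong[OF DERIV_chain2[OF DERIV_arctan t]]) (unfold th, simp only: divide_inverse mult_ac)
  moreover have "((\<lambda>\<theta>. ln (tanh (\<theta>/2))) has_real_derivative (1 - (S/C)\<^sup>2) * (1/2) / (S/C)) (at \<theta>)"
    using pos by (intro DERIV_cong[OF DERIV_chain2[OF DERIV_ln_divide t]])
      (simp add: th, unfold th, simp only: divide_inverse mult_ac mult_1_left)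
  ultimately have D: "(pot has_real_derivative (1 / sqrt d) * (2 * k ^ 3 * ((1 - (S/C)\<^sup>2) * (1/2) / (1 + (S/C)\<^sup>2))
      + (1 - (S/C)\<^sup>2) * (1/2) / (S/C))) (at \<theta>)"
    unfolding pot_def[abs_def] by (intro DERIV_cmult DERIV_add)
  have 1: "(1 - (S/C)\<^sup>2) * (1/2) / (1 + (S/C)\<^sup>2) = 1 / (2 * cosh \<theta>)"
    unfolding t' double using pos by (simp add: field_simps)
  have 2: "(1 - (S/C)\<^sup>2) * (1/2) / (S/C) = 1 / sinh \<theta>"
    unfolding t' double using pos by (simp add: field_simps power2_eq_square)
  show ?thesis using D unfolding 1 2 by (simp add: pot'_def)
qed

lemma pot'_pos: "\<theta> > 0 \<Longrightarrow> pot' \<theta> > 0"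
  using d k by (auto simp: pot'_def intro!: add_pos_pos divide_pos_pos)

lemma pot_strict_mono:
  assumes "0 < s" "s < t"
  shows "pot s < pot t"
  by (rule DERIV_pos_imp_increasing[OF assms(2)])
    (use assms pot_deriv pot'_pos in \<open>meson less_le_trans\<close>)

lemma pot_mono: "0 < s \<Longrightarrow> s \<le> t \<Longrightarrow> pot s \<le> pot t"
  using pot_strict_mono[of s t] by (cases "s = t") auto

lemma pot_tendsto_sup: "(pot \<longlongrightarrow> pot_sup) at_top"
proof -
  have "((\<lambda>\<theta>::real. tanh (\<theta> / 2)) \<longlongrightarrow> 1) at_top"
    using filterlim_compose[OF tanh_real_at_top
        filterlim_tendsto_pos_mult_at_top[OF tendsto_const, of "1/2", OF _ filterlim_ident]] by simp
  then have "(pot \<longlongrightarrow> (1 / sqrt d) * (2 * k ^ 3 * arctan 1 + ln 1)) at_top"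
    unfolding pot_def[abs_def] by (intro tendsto_intros) auto
  then show ?thesis by (simp add: pot_sup_def arctan_one mult.commute)
qed

text \<open>For positive \<theta>, cosh exceeds sinh by at most 1, so
  \<open>\<bar>gap \<theta>\<bar>\<close> grows at least like
  \<open>(k - 1) * sinh \<theta>\<close>, up to constants; here \<open>k > 1\<close>
  matters.\<close>

lemma inverse_gap_tendsto_0: "((\<lambda>\<theta>. \<alpha> * k / \<bar>gap \<theta>\<bar>) \<longlongrightarrow> 0) at_top"
proof (rule real_tendsto_divide_at_top)
  have "filterlim (\<lambda>\<theta>. sqrt d / k * (-1 + (k - 1) * sinh \<theta>)) at_top at_top"
    using d k by (intro filterlim_tendsto_pos_mult_at_top[OF tendsto_const]
        filterlim_tendsto_add_at_top[OF tendsto_const] sinh_real_at_top) auto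
  moreover have "\<forall>\<^sub>F \<theta> in at_top. sqrt d / k * (-1 + (k - 1) * sinh \<theta>) \<le> \<bar>gap \<theta>\<bar>"
  proof (rule eventually_mono[OF eventually_gt_at_top[of 0]])
    fix \<theta> :: real assume "\<theta> > 0"
    then have "exp (- \<theta>) \<le> 1" by simp
    then have "cosh \<theta> \<le> sinh \<theta> + 1" using cosh_minus_sinh[of \<theta>] by linarith
    then have "sqrt d / k * (-1 + (k - 1) * sinh \<theta>) \<le> sqrt d / k * (k * sinh \<theta> - cosh \<theta>)"
      using d k by (intro mult_left_mono) (auto simp: algebra_simps)
    also have "\<dots> = - gap \<theta>" by (simp add: gap_def algebra_simps)
    finally show "sqrt d / k * (-1 + (k - 1) * sinh \<theta>) \<le> \<bar>gap \<theta>\<bar>" by linarith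
  qed
  ultimately show "filterlim (\<lambda>\<theta>. \<bar>gap \<theta>\<bar>) at_top at_top"
    by (rule filterlim_at_top_mono)
qed (rule tendsto_const)

lemma h_tendsto_sup: "(h \<longlongrightarrow> pot_sup) at_top"
  using tendsto_add[OF pot_tendsto_sup inverse_gap_tendsto_0] by (simp add: h_def[abs_def])

text \<open>Both summands increase: \<open>pot\<close> always does, and the positive gap shrinks
  towards \<open>\<theta>g\<close>.\<close>

lemma h_strict_mono_left:
  assumes "0 < s" "s < t" "t < \<theta>g"
  shows "h s < h t"
proof -
  have "\<bar>gap t\<bar> < \<bar>gap s\<bar>" "gap t > 0"
    using gap_sign(1)[of s] gap_sign(1)[of t] gap_strict_antimono[of s t] assms by auto
  then have "\<alpha> * k / \<bar>gap s\<bar> < \<alpha> * k / \<bar>gap t\<bar>"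
    using \<alpha> k by (intro divide_strict_left_mono) auto
  then show ?thesis using pot_strict_mono[OF assms(1,2)] by (simp add: h_def)
qed

lemma h_cont:
  assumes "0 \<notin> A" "A \<subseteq> {0..}" "\<theta>g \<notin> A"
  shows "continuous_on A h"
proof -
  have "continuous_on A pot"
    by (rule continuous_at_imp_continuous_on)
      (use assms pot_deriv DERIV_isCont in \<open>metis atLeast_iff order_le_less subsetD\<close>)
  moreover have "continuous_on A gap"
    using gap_deriv DERIV_isCont by (intro continuous_at_imp_continuous_on) blast
  ultimately show ?thesis
    unfolding h_def[abs_def] using assms gap_sign(3) by (intro continuous_intros) auto
qed

text \<open>The interaction term blows up as the gap closes, while \<open>pot\<close> stays above
  \<open>pot (\<theta>g/2)\<close>; the radius at most \<open>\<theta>g/4\<close> keeps \<theta>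
  above \<open>\<theta>g/2\<close>.\<close>

lemma h_large_near_theta_g:
  obtains \<delta> where "\<delta> > 0" "\<delta> < \<theta>g / 2" "\<And>\<theta>. \<theta> \<noteq> \<theta>g \<Longrightarrow> \<bar>\<theta> - \<theta>g\<bar> < \<delta> \<Longrightarrow> h \<theta> > c"
proof -
  define m where "m = \<bar>c - pot (\<theta>g/2)\<bar> + 1"
  have m: "m > 0" by (auto simp: m_def)
  have "isCont gap \<theta>g" using gap_deriv DERIV_isCont by blast
  moreover have "\<alpha> * k / m > 0" using \<alpha> k m by simp
  ultimately obtain \<delta>0 where \<delta>0: "\<delta>0 > 0" "\<And>\<theta>. dist \<theta> \<theta>g < \<delta>0 \<Longrightarrow> dist (gap \<theta>) (gap \<theta>g) < \<alpha> * k / m"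
    unfolding continuous_at_eps_delta by blast
  show thesis
  proof (rule that)
    show "min \<delta>0 (\<theta>g/4) > 0" "min \<delta>0 (\<theta>g/4) < \<theta>g/2" using \<delta>0 theta_g_pos by auto
    fix \<theta> assume \<theta>: "\<theta> \<noteq> \<theta>g" "\<bar>\<theta> - \<theta>g\<bar> < min \<delta>0 (\<theta>g/4)"
    then have "\<bar>gap \<theta>\<bar> < \<alpha> * k / m" "gap \<theta> \<noteq> 0"
      using \<delta>0(2)[of \<theta>] gap_sign(3)[of \<theta>] gap_sign(3)[of \<theta>g] by (auto simp: dist_real_def)
    then have "m < \<alpha> * k / \<bar>gap \<theta>\<bar>" using m by (simp add: field_simps)
    moreover have "pot (\<theta>g/2) \<le> pot \<theta>" using \<theta>(2) theta_g_pos by (intro pot_mono) linarith+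
    ultimately show "c < h \<theta>" unfolding h_def m_def by linarith
  qed
qed

text \<open>Near 0 the ln term tends to minus infinity. The arctan term is bounded, and the
  interaction is at most its value \<open>M\<close> at \<open>\<theta>g/2\<close> because the gap is
  larger to the left.\<close>

lemma h_small_near_0: "\<exists>\<theta>. 0 < \<theta> \<and> \<theta> < \<theta>g \<and> h \<theta> < c"
proof -
  define M where "M = \<alpha> * k / gap (\<theta>g/2)"
  have "((\<lambda>\<theta>::real. tanh (\<theta>/2)) \<longlongrightarrow> tanh (0/2)) (at_right 0)"
    by (intro tendsto_intros) auto
  then have "filterlim (\<lambda>\<theta>::real. tanh (\<theta>/2)) (at_right 0) (at_right 0)"
    by (auto simp: filterlim_at eventually_at_filter)
  from filterlim_compose[OF ln_at_0 this]
  have "\<forall>\<^sub>F \<theta>::real in at_right 0. ln (tanh (\<theta>/2)) < sqrt d * (c - M) - k ^ 3 * pi"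
    by (simp add: filterlim_at_bot_dense)
  moreover have "\<forall>\<^sub>F \<theta>::real in at_right 0. 0 < \<theta> \<and> \<theta> < \<theta>g / 2"
    using theta_g_pos by (auto simp: eventually_at_right[of 0 1] intro!: exI[of _ "\<theta>g/2"])
  ultimately have "\<forall>\<^sub>F \<theta>::real in at_right 0. (0 < \<theta> \<and> \<theta> < \<theta>g / 2) \<and> ln (tanh (\<theta>/2)) < sqrt d * (c - M) - k ^ 3 * pi"
    by (rule eventually_conj[rotated])
  then obtain \<theta> where \<theta>: "0 < \<theta>" "\<theta> < \<theta>g / 2" and ln: "ln (tanh (\<theta>/2)) < sqrt d * (c - M) - k ^ 3 * pi"
    using eventually_happens'[OF trivial_limit_at_right_real] by blast
  have g: "gap \<theta> > gap (\<theta>g/2)" "gap (\<theta>g/2) > 0"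
    using gap_strict_antimono[OF \<theta>(2)] gap_sign(1)[of "\<theta>g/2"] theta_g_pos by auto
  then have 1: "\<alpha> * k / \<bar>gap \<theta>\<bar> \<le> M"
    unfolding M_def using \<alpha> k by (intro divide_left_mono) auto
  have "arctan (tanh (\<theta>/2)) \<le> pi / 2" using arctan_ubound[of "tanh (\<theta>/2)"] by linarith
  then have "2 * k ^ 3 * arctan (tanh (\<theta>/2)) \<le> 2 * k ^ 3 * (pi / 2)"
    using k by (intro mult_left_mono) auto
  then have "2 * k ^ 3 * arctan (tanh (\<theta>/2)) + ln (tanh (\<theta>/2)) < sqrt d * (c - M)"
    using ln by simp
  then have "pot \<theta> < (1 / sqrt d) * (sqrt d * (c - M))"
    unfolding pot_def using d by (intro mult_strict_left_mono) auto
  then have "pot \<theta> < c - M" using d by simp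
  then show ?thesis using 1 \<theta> theta_g_pos by (intro exI[of _ \<theta>]) (auto simp: h_def)
qed

lemma h_attains_left: "\<exists>\<theta>. 0 < \<theta> \<and> \<theta> < \<theta>g \<and> h \<theta> = c"
proof -
  obtain s where s: "0 < s" "s < \<theta>g" "h s < c" using h_small_near_0 by blast
  obtain \<delta> where \<delta>: "\<delta> > 0" "\<delta> < \<theta>g / 2" "\<And>\<theta>. \<theta> \<noteq> \<theta>g \<Longrightarrow> \<bar>\<theta> - \<theta>g\<bar> < \<delta> \<Longrightarrow> h \<theta> > c"
    using h_large_near_theta_g[of c] by metis
  define t where "t = max s (\<theta>g - \<delta>/2)"
  have t: "s \<le> t" "t < \<theta>g" "\<theta>g - \<delta> < t" using s \<delta> by (auto simp: t_def)
  then have "c < h t" by (intro \<delta>) auto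
  then obtain \<theta> where "s \<le> \<theta>" "\<theta> \<le> t" "h \<theta> = c"
    using IVT'[of h s c t] s t h_cont[of "{s..t}"] by (auto simp: less_imp_le)
  then show ?thesis using s t by (intro exI[of _ \<theta>]) auto
qed

lemma h_attains_right:
  assumes "u > \<theta>g" "h u < c"
  shows "\<exists>\<theta>. \<theta>g < \<theta> \<and> \<theta> < u \<and> h \<theta> = c"
proof -
  obtain \<delta> where \<delta>: "\<delta> > 0" "\<delta> < \<theta>g / 2" "\<And>\<theta>. \<theta> \<noteq> \<theta>g \<Longrightarrow> \<bar>\<theta> - \<theta>g\<bar> < \<delta> \<Longrightarrow> h \<theta> > c"
    using h_large_near_theta_g[of c] by metis
  define t where "t = min u (\<theta>g + \<delta>/2)"
  have t: "t \<le> u" "\<theta>g < t" "t < \<theta>g + \<delta>" using assms \<delta> by (auto simp: t_def)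
  then have "c < h t" by (intro \<delta>) auto
  then obtain \<theta> where \<theta>: "t \<le> \<theta>" "\<theta> \<le> u" "h \<theta> = c"
    using IVT2'[of h u c t] assms t theta_g_pos h_cont[of "{t..u}"] by (auto simp: less_imp_le)
  then have "\<theta> \<noteq> u" using assms by auto
  then show ?thesis using \<theta> t by (intro exI[of _ \<theta>]) auto
qed

section \<open>Sign of the field on the axis and the equilibria\<close>

lemma h_deriv_right:
  assumes "\<theta> > \<theta>g"
  shows "(h has_real_derivative - field2 \<theta> 0) (at \<theta>)"
proof -
  have \<theta>: "\<theta> > 0" using assms theta_g_pos by linarith
  have g: "gap \<theta> < 0" using gap_sign(2) assms by blast
  \<comment> \<open>Right of \<open>\<theta>g\<close> the gap is negative, so this smooth expression
    coincides with \<open>h\<close> on an open half line.\<close>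
  have "((\<lambda>\<theta>. pot \<theta> - \<alpha> * k / gap \<theta>) has_real_derivative pot' \<theta> + \<alpha> * k * gap' \<theta> / (gap \<theta>)\<^sup>2) (at \<theta>)"
    using g by (auto intro!: derivative_eq_intros pot_deriv[OF \<theta>] gap_deriv simp: power2_eq_square)
  moreover have "pot' \<theta> + \<alpha> * k * gap' \<theta> / (gap \<theta>)\<^sup>2 = - field2 \<theta> 0"
    using g by (simp add: field2_eq power2_eq_square power3_eq_cube)
  ultimately have "((\<lambda>\<theta>. pot \<theta> - \<alpha> * k / gap \<theta>) has_real_derivative - field2 \<theta> 0) (at \<theta>)" by simp
  then show ?thesis
    by (rule has_field_derivative_transform_within_open[of _ _ _ "{\<theta>g<..}"])
      (use assms gap_sign(2) in \<open>auto simp: h_def abs_if\<close>)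
qed

text \<open>Left of \<open>\<theta>g\<close> both summands of the second component are negative,
  since \<open>gap\<close> is positive and \<open>gap'\<close> negative.\<close>

lemma field2_neg_left:
  assumes "0 < \<theta>" "\<theta> < \<theta>g"
  shows "field2 \<theta> 0 < 0"
proof -
  have g: "gap \<theta> > 0" using gap_sign(1) assms by blast
  then have "gap \<theta> * gap' \<theta> < 0" using gap'_neg by (simp add: mult_less_0_iff)
  then have "\<alpha> * k * (gap \<theta> * gap' \<theta>) / sqrt ((gap \<theta>)\<^sup>2 + 0\<^sup>2) ^ 3 < 0"
    using \<alpha> k g by (simp add: divide_less_0_iff mult_less_0_iff zero_less_mult_iff)
  then show ?thesis using pot'_pos[OF assms(1)] by (simp add: field2_eq)
qed

text \<open>In the variable \<open>u = tanh \<theta>\<close> the equilibrium condition on the axis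
  right of \<open>\<theta>g\<close> reads \<open>balance u = \<alpha> * k\<^sup>2\<close>, with
  \<alpha> separated from the position.\<close>

definition balance :: "real \<Rightarrow> real" where
  "balance u = (k ^ 3 * u + 1) * (k * u - 1)\<^sup>2 / (u * (k - u))"

text \<open>In terms of \<open>p\<close> and \<open>q\<close>, which are \<open>gap\<close> and
  \<open>gap'\<close> up to a negative constant, \<open>balance (tanh \<theta>)\<close> equals
  \<open>(k ^ 3 / C + 1 / S) * (p\<^sup>2 / q)\<close>, whose first factor is that of
  \<open>pot'\<close>.\<close>

lemma field2_axis_right:
  assumes "\<theta> > \<theta>g"
  shows "field2 \<theta> 0 = (1 / sqrt d) * ((k * cosh \<theta> - sinh \<theta>) / (k * sinh \<theta> - cosh \<theta>)\<^sup>2) *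
      (\<alpha> * k\<^sup>2 - balance (tanh \<theta>))"
proof -
  define S where "S = sinh \<theta>"
  define C where "C = cosh \<theta>"
  define p where "p = k * S - C"
  define q where "q = k * C - S"
  define e where "e = sqrt d"
  have gap: "gap \<theta> = - (e / k * p)" "gap' \<theta> = - (e / k * q)"
    by (simp_all add: gap_def gap'_def p_def q_def S_def C_def e_def algebra_simps)
  have pos: "S > 0" "C > 0" "p > 0" "q > 0" "e > 0"
  proof -
    show "S > 0" "C > 0" "e > 0" using assms theta_g_pos d by (auto simp: S_def C_def e_def)
    then show "p > 0" "q > 0"
      using gap_sign(2)[of \<theta>] gap'_neg[of \<theta>] assms k
      by (auto simp: gap mult_less_0_iff zero_less_mult_iff zero_less_divide_iff)
  qed
  have field: "field2 \<theta> 0 = - pot' \<theta> + \<alpha> * k\<^sup>2 * q / (e * p\<^sup>2)"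
  proof -
    have "sqrt ((gap \<theta>)\<^sup>2 + 0\<^sup>2) = e / k * p"
      using pos k(2) by (simp add: gap)
    then have "field2 \<theta> 0 = - pot' \<theta> + \<alpha> * k * ((e / k * p) * (e / k * q)) / (e / k * p) ^ 3"
      by (simp add: field2_eq gap)
    then show ?thesis
      using pos k(2) by (simp add: power2_eq_square power3_eq_cube mult_ac)
  qed
  have th: "tanh \<theta> = S / C" by (simp add: S_def C_def tanh_def)
  have 1: "k * (S / C) - 1 = p / C" "k - S / C = q / C"
    using pos by (simp_all add: p_def q_def field_simps)
  have "balance (tanh \<theta>) = (k ^ 3 / C + 1 / S) * (p\<^sup>2 / q)"
    unfolding balance_def th 1 using pos by (simp add: field_simps power2_eq_square)
  then have "(1 / e) * (q / p\<^sup>2) * (\<alpha> * k\<^sup>2 - balance (tanh \<theta>)) = - pot' \<theta> + \<alpha> * k\<^sup>2 * q / (e * p\<^sup>2)"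
    using pos by (simp add: pot'_def S_def[symmetric] C_def[symmetric] e_def[symmetric] right_diff_distrib)
  then show ?thesis
    unfolding field by (simp add: p_def q_def S_def C_def e_def)
qed

lemma field2_axis_sign:
  assumes "\<theta> > \<theta>g"
  shows "field2 \<theta> 0 > 0 \<longleftrightarrow> balance (tanh \<theta>) < \<alpha> * k\<^sup>2"
    and "field2 \<theta> 0 = 0 \<longleftrightarrow> balance (tanh \<theta>) = \<alpha> * k\<^sup>2"
    and "field2 \<theta> 0 < 0 \<longleftrightarrow> balance (tanh \<theta>) > \<alpha> * k\<^sup>2"
proof -
  define K where "K = (1 / sqrt d) * ((k * cosh \<theta> - sinh \<theta>) / (k * sinh \<theta> - cosh \<theta>)\<^sup>2)"
  have "sinh \<theta> < 1 * cosh \<theta>" by (simp add: sinh_less_cosh_real)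
  also have "\<dots> \<le> k * cosh \<theta>" using k by (intro mult_right_mono) auto
  finally have "k * cosh \<theta> - sinh \<theta> > 0" by simp
  moreover have "k * sinh \<theta> - cosh \<theta> \<noteq> 0"
    using assms gap_sign(3)[of \<theta>] by (auto simp: gap_def)
  ultimately have "K > 0" using d by (simp add: K_def)
  moreover have "field2 \<theta> 0 = K * (\<alpha> * k\<^sup>2 - balance (tanh \<theta>))"
    unfolding K_def by (rule field2_axis_right[OF assms])
  ultimately show "field2 \<theta> 0 > 0 \<longleftrightarrow> balance (tanh \<theta>) < \<alpha> * k\<^sup>2"
    and "field2 \<theta> 0 = 0 \<longleftrightarrow> balance (tanh \<theta>) = \<alpha> * k\<^sup>2"
    and "field2 \<theta> 0 < 0 \<longleftrightarrow> balance (tanh \<theta>) > \<alpha> * k\<^sup>2"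
    by (auto simp: zero_less_mult_iff mult_less_0_iff)
qed

text \<open>\<open>balance\<close> factors as \<open>P * r\<close>. \<open>P\<close> is positive and
  nondecreasing; \<open>r\<close> is nonnegative and strictly increasing, its increment having the
  sign of \<open>(k * u) * (k * v) - 1\<close>, which is positive because both arguments are at
  least \<open>1 / k\<close>.\<close>

lemma balance_strict_mono:
  assumes "1 / k \<le> u" "u < v" "v \<le> 1"
  shows "balance u < balance v"
proof -
  define P where "P u = (k ^ 3 * u + 1) / (k - u)" for u
  define r where "r u = (k * u - 1)\<^sup>2 / u" for u
  have ku: "1 \<le> k * u" "1 < k * v" using assms k by (auto simp: field_simps intro: le_less_trans)
  have pos: "u > 0" "v > 0" "k - v > 0" "k - u > 0"
    using assms k by (auto intro: less_le_trans[of 0 "1/k"])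
  have split: "balance u = P u * r u" "balance v = P v * r v"
    by (simp_all add: balance_def P_def r_def)
  have "1 * 1 < (k * u) * (k * v)" using ku by (intro mult_le_less_imp_less) auto
  then have "0 < (v - u) * ((k * u) * (k * v) - 1) / (u * v)"
    using assms pos by (intro divide_pos_pos mult_pos_pos) auto
  also have "\<dots> = r v - r u"
    unfolding r_def using pos by (simp add: field_simps power2_eq_square)
  finally have r: "r u < r v" by simp
  have "P u \<le> P v" unfolding P_def using assms pos k by (intro frac_le) auto
  moreover have "P u > 0" unfolding P_def using pos k by (intro divide_pos_pos add_pos_pos) auto
  moreover have "r u \<ge> 0" using pos by (simp add: r_def)
  ultimately have "P u * r u \<le> P v * r u" "P v * r u < P v * r v"
    using r by (auto intro: mult_right_mono)
  then show ?thesis unfolding split by linarith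
qed

lemma tanh_right: "\<theta> > \<theta>g \<Longrightarrow> 1 / k < tanh \<theta>"
  using tanh_real_less_iff[of \<theta>g \<theta>] by (simp add: tanh_theta_g)

text \<open>The sign condition leaves out \<open>t\<close>, so that the equilibrium may be the right
  end point; the companion below leaves out the left one.\<close>

lemma h_antimono_if_field2_pos:
  assumes "\<theta>g < s" "s < t" "\<And>\<theta>. s \<le> \<theta> \<Longrightarrow> \<theta> < t \<Longrightarrow> field2 \<theta> 0 > 0"
  shows "h t < h s"
proof (rule DERIV_neg_imp_decreasing_open[OF assms(2)])
  fix \<theta> assume "s < \<theta>" "\<theta> < t"
  then show "\<exists>y. (h has_real_derivative y) (at \<theta>) \<and> y < 0"
    using h_deriv_right[of \<theta>] assms by force
qed (use assms theta_g_pos in \<open>auto intro!: h_cont\<close>)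

lemma h_mono_if_field2_neg:
  assumes "\<theta>g < s" "s < t" "\<And>\<theta>. s < \<theta> \<Longrightarrow> \<theta> \<le> t \<Longrightarrow> field2 \<theta> 0 < 0"
  shows "h s < h t"
proof (rule DERIV_pos_imp_increasing_open[OF assms(2)])
  fix \<theta> assume "s < \<theta>" "\<theta> < t"
  then show "\<exists>y. (h has_real_derivative y) (at \<theta>) \<and> y > 0"
    using h_deriv_right[of \<theta>] assms by force
qed (use assms theta_g_pos in \<open>auto intro!: h_cont\<close>)

text \<open>The first component vanishes only on the axis, and left of \<open>\<theta>g\<close> the
  second is negative there.\<close>

lemma is_equilibrium_iff:
  "is_equilibrium d \<gamma> \<alpha> p \<longleftrightarrow> snd p = 0 \<and> fst p > \<theta>g \<and> field2 (fst p) 0 = 0"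
proof -
  obtain \<theta> W where p: "p = (\<theta>, W)" by fastforce
  show ?thesis
  proof (cases "p \<in> Omega \<gamma>")
    case True
    then have "field1 \<theta> W = 0 \<longleftrightarrow> W = 0"
      using E_pos[of \<theta> W] \<alpha> k by (auto simp: p field1_eq)
    moreover have "\<theta> > 0" "W = 0 \<Longrightarrow> \<theta> \<noteq> \<theta>g" using True by (auto simp: p Omega_def)
    ultimately show ?thesis
      using field2_neg_left[of \<theta>] True by (auto simp: is_equilibrium_def p neq_iff)
  next
    case False
    then have "\<not> (W = 0 \<and> \<theta> > \<theta>g)"
      using theta_g_pos less_trans[of 0 \<theta>g \<theta>] unfolding p Omega_def by auto
    then show ?thesis
      using False unfolding is_equilibrium_def p by auto
  qed
qed

section \<open>Local Lipschitz continuity of the field and conservation of energy\<close>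

lemma lipschitz_near_fst_C1:
  assumes "0 < fst p"
    and "\<And>\<theta>. \<theta> > 0 \<Longrightarrow> (g has_real_derivative g' \<theta>) (at \<theta>)" "continuous_on {0<..} g'"
  shows "lipschitz_near (\<lambda>p::real\<times>real. g (fst p)) p"
  by (rule lipschitz_near_compose[OF lipschitz_near_bounded_linear[OF bounded_linear_fst]])
    (rule lipschitz_near_C1_real[of "{0<..}"], use assms in auto)

text \<open>Both components are sums and products of continuously differentiable functions of one
  coordinate and the power -3/2 of the squared distance, which is positive on
  \<open>Omega \<gamma>\<close>.\<close>

lemma lipschitz_near_field:
  assumes "p \<in> Omega \<gamma>"
  shows "lipschitz_near (\<lambda>p. (field1 (fst p) (snd p), field2 (fst p) (snd p))) p"
proof -
  have p: "fst p > 0" "(gap (fst p))\<^sup>2 + (snd p)\<^sup>2 > 0"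
    using assms E_pos[of "fst p" "snd p"] by (auto simp: Omega_def)
  have cg: "continuous_on A gap" "continuous_on A gap'" for A
    unfolding gap_def[abs_def] gap'_def[abs_def] by (intro continuous_intros; simp)+
  have dg': "(gap' has_real_derivative gap \<theta>) (at \<theta>)" for \<theta>
    unfolding gap_def gap'_def[abs_def] using k by (auto intro!: derivative_eq_intros)
  have L1: "lipschitz_near (\<lambda>p. gap (fst p)) p"
    by (rule lipschitz_near_fst_C1[OF p(1) gap_deriv cg(2)])
  have L2: "lipschitz_near (\<lambda>p. gap' (fst p)) p"
    by (rule lipschitz_near_fst_C1[OF p(1) dg' cg(1)])
  have dp: "(pot' has_real_derivative (1 / sqrt d) * (- (k ^ 3) * sinh \<theta> / (cosh \<theta>)\<^sup>2 - cosh \<theta> / (sinh \<theta>)\<^sup>2)) (at \<theta>)"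
    if "\<theta> > 0" for \<theta>
    unfolding pot'_def[abs_def]
    by (rule DERIV_cmult) (use that in \<open>auto intro!: derivative_eq_intros simp: power2_eq_square\<close>)
  have L3: "lipschitz_near (\<lambda>p. pot' (fst p)) p"
    by (rule lipschitz_near_fst_C1[OF p(1) dp]) (use d in \<open>auto intro!: continuous_intros\<close>)
  have L4: "lipschitz_near snd p"
    by (rule lipschitz_near_bounded_linear[OF bounded_linear_snd])
  have "lipschitz_near (\<lambda>u. u powr (-3/2)) ((gap (fst p))\<^sup>2 + (snd p)\<^sup>2)"
    by (rule lipschitz_near_C1_real[of "{0<..}" _ _ "\<lambda>u. (-3/2) * u powr (-3/2 - 1)"])
      (use p in \<open>auto intro!: derivative_eq_intros continuous_intros\<close>)
  then have L5: "lipschitz_near (\<lambda>p. (gap (fst p) * gap (fst p) + snd p * snd p) powr (-3/2)) p"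
    by (intro lipschitz_near_compose[of "\<lambda>p. gap (fst p) * gap (fst p) + snd p * snd p" p "\<lambda>u. u powr (-3/2)"]
      lipschitz_near_add lipschitz_near_mult L1 L4) (simp add: power2_eq_square)
  have pw: "(gap \<theta> * gap \<theta> + W * W) powr (-3/2) = 1 / sqrt (gap \<theta> * gap \<theta> + W * W) ^ 3" for \<theta> W
    by (simp add: powr_three_halves[symmetric] powr_minus_divide)
  have f1: "field1 \<theta> W = (- \<alpha> * k) * (W * (gap \<theta> * gap \<theta> + W * W) powr (-3/2))" for \<theta> W
    unfolding pw by (simp add: field1_eq power2_eq_square)
  have f2: "field2 \<theta> W = -1 * pot' \<theta> + (\<alpha> * k) * ((gap \<theta> * gap' \<theta>) * (gap \<theta> * gap \<theta> + W * W) powr (-3/2))" for \<theta> W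
    unfolding pw by (simp add: field2_eq power2_eq_square)
  show ?thesis
    unfolding f1 f2
    by (intro lipschitz_near_Pair lipschitz_near_add lipschitz_near_mult lipschitz_near_const L1 L2 L3 L4 L5)
qed

sublocale reversible_field field1 field2 "Omega \<gamma>"
proof
  fix \<theta> W assume "(\<theta>, W) \<in> Omega \<gamma>" "0 < W"
  then show "field1 \<theta> W < 0"
    using E_pos[of \<theta> W] \<alpha> k by (simp add: field1_eq)
next
  show "lipschitz_near (\<lambda>p. (field1 (fst p) (snd p), field2 (fst p) (snd p))) p" if "p \<in> Omega \<gamma>" for p
    by (rule lipschitz_near_field[OF that])
qed (simp_all add: field1_eq field2_eq)

lemma is_solution_iff: "is_solution d \<gamma> \<alpha> x \<longleftrightarrow> (\<forall>t. x t \<in> Omega \<gamma>) \<and> solves x"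
  by (auto simp: is_solution_def solves_def)

lemma Gcal_conserved:
  assumes "is_solution d \<gamma> \<alpha> x"
  shows "Gcal d \<gamma> \<alpha> (fst (x t)) (snd (x t)) = Gcal d \<gamma> \<alpha> (fst (x s)) (snd (x s))"
proof -
  have sol: "solves x" and Om: "\<And>t. x t \<in> Omega \<gamma>" using assms by (auto simp: is_solution_iff)
  have "((\<lambda>t. Gcal d \<gamma> \<alpha> (fst (x t)) (snd (x t))) has_real_derivative 0) (at t)" for t
  proof -
    define \<theta> where "\<theta> = fst (x t)"
    define W where "W = snd (x t)"
    define R where "R = sqrt ((gap \<theta>)\<^sup>2 + W\<^sup>2)"
    have pos: "\<theta> > 0" "(gap \<theta>)\<^sup>2 + W\<^sup>2 > 0"
      using Om[of t] E_pos[of \<theta> W] by (auto simp: \<theta>_def W_def Omega_def)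
    then have R: "R > 0" by (simp add: R_def)
    note D1 = solvesD(1)[OF sol, of t, folded \<theta>_def W_def]
      and D2 = solvesD(2)[OF sol, of t, folded \<theta>_def W_def]
    have P: "((\<lambda>t. pot (fst (x t))) has_real_derivative pot' \<theta> * field1 \<theta> W) (at t)"
      by (rule DERIV_chain2[OF _ D1]) (use pot_deriv[OF pos(1)] in \<open>simp add: \<theta>_def\<close>)
    have G: "((\<lambda>t. gap (fst (x t))) has_real_derivative gap' \<theta> * field1 \<theta> W) (at t)"
      by (rule DERIV_chain2[OF _ D1]) (use gap_deriv in \<open>simp add: \<theta>_def\<close>)
    have "((\<lambda>t. (gap (fst (x t)))\<^sup>2 + (snd (x t))\<^sup>2) has_real_derivative
        2 * (gap \<theta> * (gap' \<theta> * field1 \<theta> W) + W * field2 \<theta> W)) (at t)"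
      by (auto intro!: derivative_eq_intros G D2 simp: \<theta>_def W_def)
    then have "((\<lambda>t. sqrt ((gap (fst (x t)))\<^sup>2 + (snd (x t))\<^sup>2)) has_real_derivative
        (inverse R / 2) * (2 * (gap \<theta> * (gap' \<theta> * field1 \<theta> W) + W * field2 \<theta> W))) (at t)"
      using pos(2) unfolding R_def \<theta>_def W_def by (intro DERIV_chain2[OF DERIV_real_sqrt])
    then have "((\<lambda>t. sqrt ((gap (fst (x t)))\<^sup>2 + (snd (x t))\<^sup>2)) has_real_derivative
        (gap \<theta> * gap' \<theta> * field1 \<theta> W + W * field2 \<theta> W) / R) (at t)"
      by (rule DERIV_cong) (use R in \<open>simp add: field_simps\<close>)
    then have "((\<lambda>t. \<alpha> * k / sqrt ((gap (fst (x t)))\<^sup>2 + (snd (x t))\<^sup>2)) has_real_derivative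
        (0 * R - \<alpha> * k * ((gap \<theta> * gap' \<theta> * field1 \<theta> W + W * field2 \<theta> W) / R)) / (R * R)) (at t)"
      using R unfolding R_def \<theta>_def W_def by (intro DERIV_divide DERIV_const) auto
    then have S: "((\<lambda>t. \<alpha> * k / sqrt ((gap (fst (x t)))\<^sup>2 + (snd (x t))\<^sup>2)) has_real_derivative
        - (\<alpha> * k * (gap \<theta> * gap' \<theta> * field1 \<theta> W + W * field2 \<theta> W) / R ^ 3)) (at t)"
      by (rule DERIV_cong) (use R in \<open>simp add: power3_eq_cube\<close>)
    \<comment> \<open>In the derivative of the interaction term, \<open>field1\<close> has
      coefficient \<open>- (field2 + pot')\<close> and \<open>field2\<close> has coefficient
      \<open>field1\<close>. The mixed products cancel and what remains offsets the derivative of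
      \<open>pot\<close>.\<close>
    have "- (\<alpha> * k * (gap \<theta> * gap' \<theta> * field1 \<theta> W + W * field2 \<theta> W) / R ^ 3)
        = - (\<alpha> * k * (gap \<theta> * gap' \<theta>) / R ^ 3) * field1 \<theta> W + - (\<alpha> * k * W / R ^ 3) * field2 \<theta> W"
      by (simp add: add_divide_distrib distrib_left mult_ac)
    also have "\<dots> = - (field2 \<theta> W + pot' \<theta>) * field1 \<theta> W + field1 \<theta> W * field2 \<theta> W"
      by (simp add: field1_eq[of \<theta> W] field2_eq[of \<theta> W] R_def)
    also have "\<dots> = - (pot' \<theta> * field1 \<theta> W)" by (simp add: algebra_simps)
    finally show ?thesis
      using DERIV_add[OF P S] by (simp add: Gcal_eq)
  qed
  then show ?thesis using DERIV_isconst_all by blast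
qed

section \<open>Leapfrogging orbits and the two parameter regimes\<close>

lemma leapfrogging_meets_axis:
  assumes "leapfrogging d \<gamma> \<alpha> x"
  shows "\<exists>t. snd (x t) = 0 \<and> fst (x t) > \<theta>g" and "\<exists>t. snd (x t) = 0 \<and> fst (x t) < \<theta>g"
proof -
  have bdd: "bounded (connected_component_set (- range x) (\<theta>g, 0))"
    and notin: "(\<theta>g, 0) \<notin> range x"
    using assms by (auto simp: leapfrogging_def)
  \<comment> \<open>The orbit must hit both horizontal rays from \<open>(\<theta>g, 0)\<close>,
    first the one to the right; the hit is not at the excluded point itself.\<close>
  obtain r where "r \<ge> 0" "(\<theta>g, 0) + r *\<^sub>R (1, 0) \<in> range x"
    using ray_meets_if_bounded_component[OF bdd, of "(1, 0)"] by (auto simp: zero_prod_def)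
  then obtain t where "r \<ge> 0" "x t = (\<theta>g + r, 0)" by auto
  moreover from this have "r \<noteq> 0" using notin by (metis add.right_neutral rangeI)
  ultimately show "\<exists>t. snd (x t) = 0 \<and> fst (x t) > \<theta>g" by (intro exI[of _ t]) auto
  obtain r where "r \<ge> 0" "(\<theta>g, 0) + r *\<^sub>R (-1, 0) \<in> range x"
    using ray_meets_if_bounded_component[OF bdd, of "(-1, 0)"] by (auto simp: zero_prod_def)
  then obtain t where "r \<ge> 0" "x t = (\<theta>g - r, 0)" by auto
  moreover from this have "r \<noteq> 0" using notin by (metis diff_zero rangeI)
  ultimately show "\<exists>t. snd (x t) = 0 \<and> fst (x t) < \<theta>g" by (intro exI[of _ t]) auto
qed

text \<open>By uniqueness a solution through an equilibrium is constant.\<close>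

lemma leapfrogging_avoids_equilibrium:
  assumes "leapfrogging d \<gamma> \<alpha> x"
  shows "\<not> is_equilibrium d \<gamma> \<alpha> (x s)"
proof
  assume eq: "is_equilibrium d \<gamma> \<alpha> (x s)"
  have sol: "solves x" and Om: "\<And>t. x t \<in> Omega \<gamma>" and nc: "\<exists>t s. x t \<noteq> x s"
    using assms by (auto simp: leapfrogging_def is_solution_iff)
  have "solves (\<lambda>t. x s)"
    using eq by (intro solvesI) (simp_all add: is_equilibrium_def)
  then have "x t = x s" for t
    using solves_unique[OF sol _ Om, of "\<lambda>t. x s" s t] by simp
  then show False using nc by metis
qed

lemma connected_range_fst:
  "is_solution d \<gamma> \<alpha> x \<Longrightarrow> connected (range (\<lambda>t. fst (x t)))"
  using solves_continuous(1)[of x UNIV]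
  by (auto simp: is_solution_iff intro: connected_continuous_image)

text \<open>Along the solution the energy \<open>c\<close> is at most \<open>h\<close> away from
  \<open>\<theta>g\<close>, so the interval between \<open>b\<close> and \<open>b'\<close> is a
  barrier it cannot enter. Starting at or left of \<open>b\<close>, it is confined to a closed curve
  without equilibria at its turning points, to which \<open>closed_orbit\<close> applies.\<close>

lemma leapfrogging_if_barrier:
  assumes x: "is_solution d \<gamma> \<alpha> x"
    and c: "Gcal d \<gamma> \<alpha> (fst (x 0)) (snd (x 0)) = c"
    and b: "\<theta>g < b" "h b = c" "\<And>\<theta>. \<theta>g < \<theta> \<Longrightarrow> \<theta> < b \<Longrightarrow> h \<theta> > c" "field2 b 0 \<noteq> 0"
    and b': "b < b'" "\<And>\<theta>. b < \<theta> \<Longrightarrow> \<theta> < b' \<Longrightarrow> h \<theta> < c"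
    and start: "fst (x 0) \<le> b"
  shows "leapfrogging d \<gamma> \<alpha> x"
proof -
  have sol: "solves x" and Om: "\<And>t. x t \<in> Omega \<gamma>" using x by (auto simp: is_solution_iff)
  have en: "Gcal d \<gamma> \<alpha> (fst (x t)) (snd (x t)) = c" for t
    using Gcal_conserved[OF x, of t 0] c by simp
  have le_h: "c \<le> h (fst (x t))" if "fst (x t) \<noteq> \<theta>g" for t
    using Gcal_le_h[OF that] en[of t] by metis
  obtain a where a: "0 < a" "a < \<theta>g" "h a = c" using h_attains_left by blast
  have pos: "\<theta> > 0" if "a \<le> \<theta>" for \<theta> using a that by linarith
  \<comment> \<open>\<open>pot b\<close> lies below \<open>h b = c\<close> by the positive
    interaction term and \<open>pot\<close> increases, so \<open>c - pot\<close> is positive up to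
    \<open>b\<close>.\<close>
  have "\<alpha> * k / \<bar>gap b\<bar> > 0" using gap_sign(3)[of b] b(1) \<alpha> k(2) by simp
  then have "pot b < h b" unfolding h_def by linarith
  then have pot: "pot \<theta> < c" if "\<theta> \<in> {a..b}" for \<theta>
    using pot_mono[of \<theta> b] that pos b by force
  \<comment> \<open>Obtained by solving \<open>Gcal d \<gamma> \<alpha> \<theta> W = c\<close> for
    \<open>W\<^sup>2\<close>.\<close>
  define w where "w \<theta> = (\<alpha> * k / (c - pot \<theta>))\<^sup>2 - (gap \<theta>)\<^sup>2" for \<theta>
  have w_end: "w \<theta> = 0" if "h \<theta> = c" "\<theta> \<noteq> \<theta>g" for \<theta>
  proof -
    have "c - pot \<theta> = \<alpha> * k / \<bar>gap \<theta>\<bar>" using that by (auto simp: h_def)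
    then show ?thesis using that gap_sign(3)[of \<theta>] \<alpha> k by (simp add: w_def)
  qed
  have w_pos: "w \<theta> > 0" if "a < \<theta>" "\<theta> < b" for \<theta>
  proof -
    have p: "c - pot \<theta> > 0" using pot that by simp
    \<comment> \<open>At \<open>\<theta>g\<close> the left side is 0; elsewhere this is
      \<open>h \<theta> > c\<close> rearranged.\<close>
    have "\<bar>gap \<theta>\<bar> < \<alpha> * k / (c - pot \<theta>)"
    proof (cases "\<theta> = \<theta>g")
      case True
      then have "gap \<theta> = 0" using gap_sign(3) by blast
      then show ?thesis using p \<alpha> k(2) by simp
    next
      case False
      have "h \<theta> > c"
      proof (cases "\<theta> < \<theta>g")
        case True
        then show ?thesis using h_strict_mono_left[of a \<theta>] a that by simp
      qed (use b that False in auto)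
      then have "c - pot \<theta> < \<alpha> * k / \<bar>gap \<theta>\<bar>" by (simp add: h_def)
      then show ?thesis using p False gap_sign(3)[of \<theta>] by (simp add: field_simps)
    qed
    then have "\<bar>gap \<theta>\<bar>\<^sup>2 < (\<alpha> * k / (c - pot \<theta>))\<^sup>2" by (intro power_strict_mono) auto
    then show ?thesis by (simp add: w_def)
  qed
  have w_cont: "continuous_on {a..b} w"
  proof -
    have "continuous_on {a..b} pot" "continuous_on {a..b} gap"
      using pot_deriv gap_deriv pos DERIV_isCont
      by (metis atLeastAtMost_iff continuous_at_imp_continuous_on)+
    then show ?thesis
      unfolding w_def[abs_def] using pot by (intro continuous_intros) force+
  qed
  interpret reversible_orbit field1 field2 "Omega \<gamma>" w a b
  proof
    show "a < b" using a b by linarith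
    show "continuous_on {a..b} w" by fact
    show "w a = 0" "w b = 0" using w_end a b by auto
    show "0 < w \<theta>" if "a < \<theta>" "\<theta> < b" for \<theta> using w_pos that .
    show "(\<theta>, W) \<in> Omega \<gamma>" if "\<theta> \<in> {a..b}" "W\<^sup>2 = w \<theta>" for \<theta> W
      using that pos w_pos[of \<theta>g] a b by (auto simp: Omega_def)
    show "field2 a 0 \<noteq> 0" using field2_neg_left[OF a(1,2)] by simp
    show "field2 b 0 \<noteq> 0" by fact
  qed
  have upper: "fst (x t) \<le> b" for t
  proof (rule ccontr)
    assume neg: "\<not> fst (x t) \<le> b"
    \<comment> \<open>By connectedness a solution passing beyond \<open>b\<close> would take this
      value inside the barrier.\<close>
    define m where "m = min (fst (x t)) ((b + b') / 2)"
    have m: "b < m" "m < b'" "m \<le> fst (x t)"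
      using neg b' unfolding m_def by (auto simp: min_def)
    then have "m \<in> range (\<lambda>t. fst (x t))"
      using connectedD_interval[OF connected_range_fst[OF x], of "fst (x 0)" "fst (x t)" m] start by auto
    then obtain s where "fst (x s) = m" by auto
    then show False using le_h[of s] b'(2)[of m] m b by auto
  qed
  have lower: "a \<le> fst (x t)" for t
  proof (rule ccontr)
    assume "\<not> a \<le> fst (x t)"
    moreover have "fst (x t) > 0" using Om[of t] by (auto simp: Omega_def)
    ultimately show False using le_h[of t] h_strict_mono_left[of "fst (x t)" a] a by auto
  qed
  have lev: "x t \<in> level" for t
  proof -
    define \<theta> where "\<theta> = fst (x t)"
    define W where "W = snd (x t)"
    have th: "\<theta> \<in> {a..b}" using upper lower by (simp add: \<theta>_def)
    have E: "(gap \<theta>)\<^sup>2 + W\<^sup>2 > 0" using E_pos[of \<theta> W] Om[of t] by (simp add: \<theta>_def W_def)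
    have "c - pot \<theta> = \<alpha> * k / sqrt ((gap \<theta>)\<^sup>2 + W\<^sup>2)"
      using en[of t] by (simp add: Gcal_eq \<theta>_def W_def)
    then have "\<alpha> * k / (c - pot \<theta>) = sqrt ((gap \<theta>)\<^sup>2 + W\<^sup>2)" using \<alpha> k by simp
    then have "w \<theta> = W\<^sup>2" using E by (simp add: w_def)
    then show ?thesis
      using th unfolding level_def by (auto simp: \<theta>_def W_def case_prod_beta)
  qed
  note orbit = closed_orbit[OF sol lev]
  have "(a, 0) \<in> level" "(b, 0) \<in> level" using w_ends ab by (auto simp: level_def)
  then have "(a, 0) \<in> range x" "(b, 0) \<in> range x" using orbit(1) by simp_all
  then have nonconst: "\<exists>t s. x t \<noteq> x s" using ab by (metis Pair_inject imageE less_irrefl)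
  have "bounded (connected_component_set (- range x) (\<theta>g, 0))"
    unfolding orbit(1) level_def
    by (rule bounded_component_inside_graph) (use ab w_cont w_ends w_pos[of \<theta>g] a b in auto)
  moreover have "range x \<subseteq> Omega \<gamma>" using Om by auto
  moreover have "(\<theta>g, 0) \<notin> Omega \<gamma>" by (simp add: Omega_def)
  ultimately show ?thesis
    unfolding leapfrogging_def using x nonconst orbit(2) by blast
qed

text \<open>\<open>balance (tanh \<theta>)\<close> stays below \<open>balance 1\<close>, so
  \<open>field2\<close> is positive on the whole axis right of \<open>\<theta>g\<close>. There
  \<open>h\<close> strictly decreases to \<open>pot_sup\<close>, and the values it takes are the
  energies above \<open>pot_sup\<close>.\<close>

lemma subcritical:
  assumes "balance 1 \<le> \<alpha> * k\<^sup>2"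
  shows "\<not> is_equilibrium d \<gamma> \<alpha> p"
    and "is_solution d \<gamma> \<alpha> x \<Longrightarrow> leapfrogging d \<gamma> \<alpha> x \<longleftrightarrow>
      Gcal d \<gamma> \<alpha> (fst (x 0)) (snd (x 0)) > pot_sup"
proof -
  have field2: "field2 \<theta> 0 > 0" if "\<theta> > \<theta>g" for \<theta>
    using balance_strict_mono[of "tanh \<theta>" 1] tanh_right[OF that] assms tanh_real_lt_1[of \<theta>]
    by (simp add: field2_axis_sign[OF that])
  then show "\<not> is_equilibrium d \<gamma> \<alpha> p"
    by (auto simp: is_equilibrium_iff dest: field2)
  have anti: "h t < h s" if "\<theta>g < s" "s < t" for s t
    using h_antimono_if_field2_pos[OF that] field2 that by auto
  assume x: "is_solution d \<gamma> \<alpha> x"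
  define c where "c = Gcal d \<gamma> \<alpha> (fst (x 0)) (snd (x 0))"
  show "leapfrogging d \<gamma> \<alpha> x \<longleftrightarrow> Gcal d \<gamma> \<alpha> (fst (x 0)) (snd (x 0)) > pot_sup"
  proof
    assume "leapfrogging d \<gamma> \<alpha> x"
    then obtain t where t: "snd (x t) = 0" "fst (x t) > \<theta>g"
      using leapfrogging_meets_axis by blast
    \<comment> \<open>The intermediate point \<open>fst (x t) + 1\<close> makes the comparison with
      the limit strict.\<close>
    have "pot_sup \<le> h (fst (x t) + 1)"
    proof (rule tendsto_upperbound[OF h_tendsto_sup])
      show "\<forall>\<^sub>F u in at_top. h u \<le> h (fst (x t) + 1)"
        by (rule eventually_mono[OF eventually_gt_at_top[of "fst (x t) + 1"]])
          (use anti t in \<open>auto intro: less_imp_le\<close>)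
    qed auto
    also have "\<dots> < h (fst (x t))" using anti t by simp
    also have "\<dots> = Gcal d \<gamma> \<alpha> (fst (x 0)) (snd (x 0))"
      using Gcal_conserved[OF x, of t 0] t by (simp add: Gcal_axis)
    finally show "pot_sup < Gcal d \<gamma> \<alpha> (fst (x 0)) (snd (x 0))" .
  next
    assume "pot_sup < Gcal d \<gamma> \<alpha> (fst (x 0)) (snd (x 0))"
    then have "\<forall>\<^sub>F u in at_top. h u < c \<and> u > \<theta>g"
      using order_tendstoD(2)[OF h_tendsto_sup, of c] eventually_gt_at_top
      by (auto simp: c_def intro: eventually_conj)
    then obtain u where "h u < c" "u > \<theta>g"
      using eventually_happens'[OF trivial_limit_at_top_linorder] by blast
    then obtain b where b: "\<theta>g < b" "h b = c" using h_attains_right by blast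
    have "fst (x 0) \<le> b"
      using Gcal_le_h[of "fst (x 0)" "snd (x 0)"] anti[of b "fst (x 0)"] b
      by (force simp: c_def)
    \<comment> \<open>Any barrier length serves, as \<open>h\<close> stays below \<open>c\<close>
      everywhere right of \<open>b\<close>.\<close>
    then show "leapfrogging d \<gamma> \<alpha> x"
      using b anti field2[of b] by (intro leapfrogging_if_barrier[OF x c_def[symmetric], of b "b + 1"]) auto
  qed
qed

text \<open>\<open>balance\<close> is 0 at \<open>1/k\<close> and exceeds
  \<open>\<alpha> * k\<^sup>2\<close> at 1, so it crosses that level once, at some \<open>u\<close>
  strictly between; the equilibrium is at \<open>artanh u\<close>, where \<open>h\<close> turns from
  decreasing to increasing.\<close>

lemma supercritical:
  assumes "balance 1 > \<alpha> * k\<^sup>2"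
  obtains \<theta>s where "\<theta>s > \<theta>g" "{p. is_equilibrium d \<gamma> \<alpha> p} = {(\<theta>s, 0)}"
    "\<And>s t. \<theta>g < s \<Longrightarrow> s < t \<Longrightarrow> t \<le> \<theta>s \<Longrightarrow> h t < h s"
    "\<And>s t. \<theta>s \<le> s \<Longrightarrow> s < t \<Longrightarrow> h s < h t"
proof -
  have "continuous_on {1/k..1} balance"
    unfolding balance_def[abs_def] using k by (intro continuous_intros) (auto simp: field_simps)
  moreover have "balance (1/k) \<le> \<alpha> * k\<^sup>2" using k(2) \<alpha> by (simp add: balance_def)
  ultimately obtain u where u: "1/k \<le> u" "u \<le> 1" "balance u = \<alpha> * k\<^sup>2"
    using IVT'[of balance "1/k" "\<alpha> * k\<^sup>2" 1] assms k by auto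
  have "u \<noteq> 1/k" using u(3) k \<alpha> by (auto simp: balance_def)
  moreover have "u \<noteq> 1" using u(3) assms by auto
  ultimately have u': "1/k < u" "u < 1" using u by auto
  define \<theta>s where "\<theta>s = artanh u"
  have "1/k > 0" using k by simp
  then have "u > 0" using u' by linarith
  then have th: "tanh \<theta>s = u" unfolding \<theta>s_def using u' by (intro tanh_artanh_real) auto
  then have gt: "\<theta>s > \<theta>g" using u' tanh_theta_g tanh_real_less_iff[of \<theta>g \<theta>s] by simp
  have pos: "field2 \<theta> 0 > 0" if "\<theta>g < \<theta>" "\<theta> < \<theta>s" for \<theta>
    using balance_strict_mono[of "tanh \<theta>" u] tanh_right[OF that(1)] that u
      tanh_real_less_iff[of \<theta> \<theta>s, unfolded th]
    by (simp add: field2_axis_sign[OF that(1)] less_imp_le)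
  have neg: "field2 \<theta> 0 < 0" if "\<theta>s < \<theta>" for \<theta>
    using balance_strict_mono[of u "tanh \<theta>"] that gt u tanh_real_lt_1[of \<theta>]
      tanh_real_less_iff[of \<theta>s \<theta>, unfolded th]
    by (simp add: field2_axis_sign[of \<theta>] less_imp_le)
  have zero: "field2 \<theta>s 0 = 0" using th u gt by (simp add: field2_axis_sign)
  have "field2 \<theta> 0 = 0 \<longleftrightarrow> \<theta> = \<theta>s" if "\<theta>g < \<theta>" for \<theta>
    using pos[of \<theta>] neg[of \<theta>] zero that by (metis less_irrefl less_linear)
  then have "{p. is_equilibrium d \<gamma> \<alpha> p} = {(\<theta>s, 0)}"
    using gt by (auto simp: is_equilibrium_iff)
  then show thesis
    using gt pos neg h_antimono_if_field2_pos h_mono_if_field2_neg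
    by (intro that[of \<theta>s]) auto
qed

text \<open>Energies above \<open>h \<theta>s\<close> cannot cross the vertical line at
  \<open>\<theta>s\<close>. Conversely such an energy gives a barrier just left of
  \<open>\<theta>s\<close>.\<close>

lemma supercritical_leapfrogging:
  assumes \<theta>s: "\<theta>s > \<theta>g" "{p. is_equilibrium d \<gamma> \<alpha> p} = {(\<theta>s, 0)}"
    and anti: "\<And>s t. \<theta>g < s \<Longrightarrow> s < t \<Longrightarrow> t \<le> \<theta>s \<Longrightarrow> h t < h s"
    and mono: "\<And>s t. \<theta>s \<le> s \<Longrightarrow> s < t \<Longrightarrow> h s < h t"
    and \<theta>b: "0 < \<theta>b" "\<theta>b < \<theta>g" "h \<theta>b = h \<theta>s"
    and x: "is_solution d \<gamma> \<alpha> x"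
  shows "leapfrogging d \<gamma> \<alpha> x \<longleftrightarrow> \<theta>b < fst (x 0) \<and> fst (x 0) < \<theta>s \<and>
    Gcal d \<gamma> \<alpha> (fst (x 0)) (snd (x 0)) > h \<theta>s"
proof -
  define c where "c = Gcal d \<gamma> \<alpha> (fst (x 0)) (snd (x 0))"
  have en: "Gcal d \<gamma> \<alpha> (fst (x t)) (snd (x t)) = c" for t
    using Gcal_conserved[OF x, of t 0] by (simp add: c_def)
  have le_h: "c \<le> h (fst (x t))" if "fst (x t) \<noteq> \<theta>g" for t
    using Gcal_le_h[OF that] en[of t] by metis
  have min: "h \<theta>s < h \<theta>" if "\<theta>g < \<theta>" "\<theta> \<noteq> \<theta>s" for \<theta>
    using anti[of \<theta> \<theta>s] mono[of \<theta>s \<theta>] that \<theta>s(1) by (cases "\<theta> < \<theta>s") auto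
  have "x 0 \<in> Omega \<gamma>" using x by (auto simp: is_solution_iff)
  then have pos: "fst (x 0) > 0" by (auto simp: Omega_def)
  show ?thesis unfolding c_def[symmetric]
  proof
    assume leap: "leapfrogging d \<gamma> \<alpha> x"
    obtain t1 where t1: "snd (x t1) = 0" "fst (x t1) > \<theta>g"
      using leapfrogging_meets_axis(1)[OF leap] by blast
    obtain t2 where t2: "fst (x t2) < \<theta>g"
      using leapfrogging_meets_axis(2)[OF leap] by blast
    have "x t1 \<noteq> (\<theta>s, 0)"
      using leapfrogging_avoids_equilibrium[OF leap, of t1] \<theta>s(2) by (metis insertI1 mem_Collect_eq)
    then have "fst (x t1) \<noteq> \<theta>s" using t1 by (metis prod.collapse)
    then have "h \<theta>s < h (fst (x t1))" using min t1 by blast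
    then have c: "c > h \<theta>s" using en[of t1] t1 by (simp add: Gcal_axis)
    \<comment> \<open>No point over \<open>\<theta>s\<close> has energy above
      \<open>h \<theta>s\<close>. As the orbit also visits the left of \<open>\<theta>g\<close>,
      connectedness keeps all of it left of \<open>\<theta>s\<close>.\<close>
    have ne: "fst (x t) \<noteq> \<theta>s" for t using le_h[of t] c \<theta>s(1) by auto
    have "fst (x 0) < \<theta>s"
    proof (rule ccontr)
      assume "\<not> fst (x 0) < \<theta>s"
      then have "\<theta>s \<in> range (\<lambda>t. fst (x t))"
        using connectedD_interval[OF connected_range_fst[OF x], of "fst (x t2)" "fst (x 0)" \<theta>s] t2 \<theta>s(1)
        by auto
      then show False using ne by auto
    qed
    moreover have "\<theta>b < fst (x 0)"
    proof (rule ccontr)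
      assume "\<not> \<theta>b < fst (x 0)"
      then have "h (fst (x 0)) \<le> h \<theta>b"
        using h_strict_mono_left[of "fst (x 0)" \<theta>b] pos \<theta>b by (cases "fst (x 0) = \<theta>b") auto
      then show False
        using le_h[of 0] c \<theta>b \<open>\<not> \<theta>b < fst (x 0)\<close> by auto
    qed
    ultimately show "\<theta>b < fst (x 0) \<and> fst (x 0) < \<theta>s \<and> c > h \<theta>s" using c by blast
  next
    assume *: "\<theta>b < fst (x 0) \<and> fst (x 0) < \<theta>s \<and> c > h \<theta>s"
    \<comment> \<open>The right turning point lies before \<open>\<theta>s\<close>; since
      \<open>h\<close> decreases up to \<open>\<theta>s\<close>, the barrier extends from
      \<open>b\<close> to there.\<close>
    then obtain b where b: "\<theta>g < b" "b < \<theta>s" "h b = c"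
      using h_attains_right[OF \<theta>s(1), of c] by blast
    have "fst (x 0) \<le> b"
      using le_h[of 0] anti[of b "fst (x 0)"] b * by force
    moreover have "field2 b 0 \<noteq> 0"
    proof
      assume "field2 b 0 = 0"
      then have "(b, 0) \<in> {p. is_equilibrium d \<gamma> \<alpha> p}" using b by (simp add: is_equilibrium_iff)
      then show False using b unfolding \<theta>s(2) by auto
    qed
    ultimately show "leapfrogging d \<gamma> \<alpha> x"
      using b anti by (intro leapfrogging_if_barrier[OF x c_def[symmetric], of b \<theta>s]) auto
  qed
qed

end

section \<open>The threshold value of \<gamma>\<close>

lemma threshold_strict_mono:
  fixes s t :: real
  assumes "1 \<le> s" "s < t"
  shows "(s ^ 3 + 1) * (s - 1) / s\<^sup>2 < (t ^ 3 + 1) * (t - 1) / t\<^sup>2"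
proof -
  \<comment> \<open>\<open>u ^ 3 + 1\<close> contains \<open>u + 1\<close>, which joins
    \<open>u - 1\<close> to form the first factor, nonnegative and strictly increasing; the second
    is positive and nondecreasing for \<open>u \<ge> 1\<close>.\<close>
  have factor: "(u ^ 3 + 1) * (u - 1) / u\<^sup>2 = (1 - 1 / u\<^sup>2) * (u * (u - 1) + 1)" if "u \<ge> 1" for u :: real
    using that by (simp add: field_simps power2_eq_square power3_eq_cube)
  have "s\<^sup>2 < t\<^sup>2" using assms by (intro power_strict_mono) auto
  then have 1: "1 - 1 / s\<^sup>2 < 1 - 1 / t\<^sup>2" using assms by (simp add: frac_less2)
  have "1 \<le> s\<^sup>2" using assms by simp
  then have 0: "0 \<le> 1 - 1 / s\<^sup>2" by (simp add: divide_le_eq)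
  have "s * (s - 1) \<le> t * (t - 1)" using assms by (intro mult_mono) auto
  moreover have "s * (s - 1) \<ge> 0" using assms by simp
  ultimately have "(1 - 1 / s\<^sup>2) * (s * (s - 1) + 1) < (1 - 1 / t\<^sup>2) * (t * (t - 1) + 1)"
    using 0 1 by (intro mult_less_le_imp_less) auto
  then show ?thesis using assms factor by simp
qed

theorem theorem4:
  fixes \<alpha> :: real
  assumes "0 < \<alpha>" and "\<alpha> < 1/3"
  shows "\<exists>\<gamma>s > 1. \<forall>d > 0.
    (\<forall>\<gamma>. 1 < \<gamma> \<and> \<gamma> \<le> \<gamma>s \<longrightarrow>
       (\<forall>p. \<not> is_equilibrium d \<gamma> \<alpha> p) \<and>
       (\<forall>\<theta>0 W0. (\<theta>0, W0) \<in> Omega \<gamma> \<longrightarrow>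
          (\<forall>x. is_solution d \<gamma> \<alpha> x \<and> x 0 = (\<theta>0, W0) \<longrightarrow>
             (leapfrogging d \<gamma> \<alpha> x \<longleftrightarrow>
              Gcal d \<gamma> \<alpha> \<theta>0 W0 > pi * \<gamma> powr (3/2) / (2 * sqrt d))))) \<and>
    (\<forall>\<gamma>. \<gamma> > \<gamma>s \<longrightarrow>
       (\<exists>\<theta>s. \<theta>s > theta_g \<gamma> \<and>
          {p. is_equilibrium d \<gamma> \<alpha> p} = {(\<theta>s, 0)} \<and>
          (\<exists>\<theta>b. 0 < \<theta>b \<and> \<theta>b < theta_g \<gamma> \<and> Gcal d \<gamma> \<alpha> \<theta>b 0 = Gcal d \<gamma> \<alpha> \<theta>s 0 \<and>
             (\<forall>\<theta>'. 0 < \<theta>' \<and> \<theta>' < theta_g \<gamma> \<and> Gcal d \<gamma> \<alpha> \<theta>' 0 = Gcal d \<gamma> \<alpha> \<theta>s 0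
                 \<longrightarrow> \<theta>' = \<theta>b) \<and>
             (\<forall>\<theta>0 W0. (\<theta>0, W0) \<in> Omega \<gamma> \<longrightarrow>
                (\<forall>x. is_solution d \<gamma> \<alpha> x \<and> x 0 = (\<theta>0, W0) \<longrightarrow>
                   (leapfrogging d \<gamma> \<alpha> x \<longleftrightarrow>
                    \<theta>b < \<theta>0 \<and> \<theta>0 < \<theta>s \<and>
                    Gcal d \<gamma> \<alpha> \<theta>0 W0 > Gcal d \<gamma> \<alpha> \<theta>s 0))))))"
proof -
  \<comment> \<open>\<open>T k\<close> is \<open>balance 1 / k\<^sup>2\<close>, so the regimes are
    separated by \<open>T k = \<alpha>\<close>, independently of \<open>d\<close>. As
    \<open>T 1 = 0\<close> and \<open>T 2 = 9/4\<close>, the level \<alpha> is attained between 1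
    and 2.\<close>
  define T :: "real \<Rightarrow> real" where "T = (\<lambda>s. (s ^ 3 + 1) * (s - 1) / s\<^sup>2)"
  have T_mono: "T s < T t" if "1 \<le> s" "s < t" for s t
    using threshold_strict_mono[OF that] by (simp add: T_def)
  have "continuous_on {1..2} T"
    unfolding T_def by (intro continuous_intros) auto
  moreover have "T 1 \<le> \<alpha>" "\<alpha> \<le> T 2" using assms by (simp_all add: T_def)
  ultimately obtain ks where ks: "1 \<le> ks" "T ks = \<alpha>"
    using IVT'[of T 1 \<alpha> 2] by auto
  have "ks \<noteq> 1" using ks assms by (auto simp: T_def)
  then have ks1: "ks > 1" using ks by simp
  have balance: "vortex.balance \<gamma> 1 \<le> \<alpha> * (vortex.k \<gamma>)\<^sup>2 \<longleftrightarrow> \<gamma> \<le> ks\<^sup>2"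
    if "vortex d \<gamma> \<alpha>" for d \<gamma>
  proof -
    interpret vortex d \<gamma> \<alpha> by fact
    have "balance 1 = T k * k\<^sup>2"
      using k(1) by (simp add: balance_def T_def power2_eq_square)
    then have "balance 1 \<le> \<alpha> * k\<^sup>2 \<longleftrightarrow> T k \<le> T ks"
      using k(2) ks by simp
    also have "\<dots> \<longleftrightarrow> k \<le> ks"
      using T_mono[of k ks] T_mono[of ks k] k ks by (metis less_imp_le linorder_not_le order_refl order_less_le)
    also have "\<dots> \<longleftrightarrow> k\<^sup>2 \<le> ks\<^sup>2"
      using k(2) ks by (simp add: power_mono_iff)
    finally show ?thesis unfolding k(3) .
  qed
  show ?thesis
  \<comment> \<open>The threshold is squared because \<open>k\<close> is the square root of
    \<gamma>.\<close>
  proof (rule exI[of _ "ks\<^sup>2"], intro conjI allI impI, goal_cases)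
    case 1
    then show ?case using ks1 by simp
  next
    case (2 d \<gamma> p)
    then interpret vortex d \<gamma> \<alpha> using assms by unfold_locales auto
    show ?case using subcritical(1) balance[OF vortex_axioms] 2 by blast
  next
    case (3 d \<gamma> \<theta>0 W0 x)
    then interpret vortex d \<gamma> \<alpha> using assms by unfold_locales auto
    have "leapfrogging d \<gamma> \<alpha> x \<longleftrightarrow> Gcal d \<gamma> \<alpha> (fst (x 0)) (snd (x 0)) > pot_sup"
      using subcritical(2) balance[OF vortex_axioms] 3 by blast
    then show ?case using 3 k by (simp add: pot_sup_def)
  next
    case (4 d \<gamma>)
    moreover have "\<gamma> > 1" using 4 ks1 by (meson less_trans one_less_power pos2)
    ultimately interpret vortex d \<gamma> \<alpha> using assms by unfold_locales auto
    have "balance 1 > \<alpha> * k\<^sup>2" using balance[OF vortex_axioms] 4 by linarith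
    then obtain \<theta>s where \<theta>s: "\<theta>s > \<theta>g" "{p. is_equilibrium d \<gamma> \<alpha> p} = {(\<theta>s, 0)}"
      "\<And>s t. \<theta>g < s \<Longrightarrow> s < t \<Longrightarrow> t \<le> \<theta>s \<Longrightarrow> h t < h s"
      "\<And>s t. \<theta>s \<le> s \<Longrightarrow> s < t \<Longrightarrow> h s < h t"
      by (rule supercritical) blast
    \<comment> \<open>Every level is attained by \<open>h\<close> left of \<open>\<theta>g\<close>;
      strict monotonicity there gives uniqueness below.\<close>
    obtain \<theta>b where \<theta>b: "0 < \<theta>b" "\<theta>b < \<theta>g" "h \<theta>b = h \<theta>s" using h_attains_left by blast
    show ?case unfolding Gcal_axis
    proof (rule exI[of _ \<theta>s], intro conjI, goal_cases)
      case 3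
      show ?case
      proof (rule exI[of _ \<theta>b], intro conjI allI impI, goal_cases)
        case (4 \<theta>')
        then show ?case
          using h_strict_mono_left[of \<theta>' \<theta>b] h_strict_mono_left[of \<theta>b \<theta>'] \<theta>b
          by (cases \<theta>' \<theta>b rule: linorder_cases) auto
      next
        case (5 \<theta>0 W0 x)
        then show ?case
          using supercritical_leapfrogging[OF \<theta>s \<theta>b, of x] by simp
      qed (use \<theta>b in auto)
    qed (use \<theta>s in auto)
  qed
qed

end
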